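(* Let $\eta,\omega\in\mathbb{R}$ with $\omega\neq 0$, and let $\mathcal{A}_S$, $\pi$, $\Theta$, $\mathcal{D}$ on $\mathcal{H}$ be as in the context. Then for all $f,g\in\mathcal{A}_S$ and every $s>2$, the operator $\pi(f)\,\Theta\,(1+\mathcal{D}^2)^{-s/2}\,\pi(g)$ is trace-class on $\mathcal{H}$.
   Context: Let $\hat{H}=L^2(\mathbb{R}^2,da\,db)$; write its elements as $\xi(a)(b)$. Let $\mathcal{A}_S=\mathcal{S}_c(\mathbb{R}^2)$ be the space of Schwartz functions $f(a)(b)$ of $(a,b)\in\mathbb{R}^2$ having compact support in the variable $a$; it is a $*$-algebra for $(f\star g)(a)(b)=\int_{\mathbb{R}^2}da'\,db'\,e^{a'}f(a')(b')\,g(a-a')(e^{a'}(b-b'))$ and $f^*(a)(b)=e^{a}\overline{f(-a)(-e^{a}b)}$ (a dense $*$-subalgebra of the crossed product $C^*$-algebra of the affine group $\mathbb{R}\ltimes\mathbb{R}$). Its representation on $\hat H$ is $(\hat\rho(f)\xi)(a)(b)=e^{-a}\int_{\mathbb{R}^2}da'\,db'\,f(a')(e^{-a}b')\,\xi(a-a')(b-b')$. Define the (selfadjoint, maximal-domain) multiplication operators on $\hat H$: $(\hat D\xi)(a)(b)=e^{-a}b\,\xi(a)(b)$, $(\mathcal{T}\xi)(a)(b)=(\eta+\omega e^{-a})\xi(a)(b)$, $(\hat\theta\xi)(a)(b)=e^{-a}\xi(a)(b)$. Let $\mathcal{H}=\hat H\otimes\mathbb{C}^2$, $\pi=\hat\rho\otimes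 1$, $\mathcal{D}=\hat D\otimes\gamma^1+\mathcal{T}\otimes\gamma^2$ where $\gamma^1,\gamma^2$ are the selfadjoint Pauli matrices, and $\Theta=\hat\theta\otimes 1$. (Since $\hat D$ and $\mathcal T$ commute, $\mathcal{D}^2=(\hat D^2+\mathcal{T}^2)\otimes 1_2$.) *)

theory Defs
  imports "HOL-Analysis.Analysis"
begin

text \<open>Points of the underlying measure space: ((a,b), i) with (a,b) in R^2 and
  i :: bool indexing the two components of C^2.  The measure is Lebesgue (Borel)
  measure on R^2 times counting measure on the two-point set.\<close>

type_synonym pt = "(real \<times> real) \<times> bool"

definition hmeas :: "pt measure" where
  "hmeas = (lborel :: (real \<times> real) measure) \<Otimes>\<^sub>M count_space (UNIV :: bool set)"

definition inL2 :: "(pt \<Rightarrow> complex) \<Rightarrow> bool" where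
  "inL2 u \<longleftrightarrow> u \<in> borel_measurable hmeas \<and> integrable hmeas (\<lambda>x. (cmod (u x))\<^sup>2)"

definition l2inner :: "(pt \<Rightarrow> complex) \<Rightarrow> (pt \<Rightarrow> complex) \<Rightarrow> complex" where
  "l2inner u v = (LINT x|hmeas. cnj (u x) * v x)"

definition l2norm :: "(pt \<Rightarrow> complex) \<Rightarrow> real" where
  "l2norm u = sqrt (LINT x|hmeas. (cmod (u x))\<^sup>2)"

definition trace_class :: "((pt \<Rightarrow> complex) \<Rightarrow> (pt \<Rightarrow> complex)) \<Rightarrow> bool" where
  "trace_class T \<longleftrightarrow>
     (\<forall>\<xi>. inL2 \<xi> \<longrightarrow> inL2 (T \<xi>)) \<and>
     (\<exists>u v :: nat \<Rightarrow> pt \<Rightarrow> complex.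
        (\<forall>n. inL2 (u n) \<and> inL2 (v n)) \<and>
        summable (\<lambda>n. l2norm (u n) * l2norm (v n)) \<and>
        (\<forall>\<xi>. inL2 \<xi> \<longrightarrow>
           (\<lambda>N. l2norm (\<lambda>x. T \<xi> x - (\<Sum>n<N. l2inner (u n) \<xi> * v n x))) \<longlonglongrightarrow> 0))"

definition pd :: "bool \<Rightarrow> (real \<Rightarrow> real \<Rightarrow> complex) \<Rightarrow> real \<Rightarrow> real \<Rightarrow> complex" where
  "pd d g a b = (if d then vector_derivative (\<lambda>t. g t b) (at a)
                 else vector_derivative (\<lambda>t. g a t) (at b))"

definition iterpd :: "bool list \<Rightarrow> (real \<Rightarrow> real \<Rightarrow> complex) \<Rightarrow> real \<Rightarrow> real \<Rightarrow> complex" where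
  "iterpd ds g = fold pd ds g"

definition schwartz :: "(real \<Rightarrow> real \<Rightarrow> complex) \<Rightarrow> bool" where
  "schwartz f \<longleftrightarrow>
     (\<forall>ds. continuous_on UNIV (\<lambda>p. iterpd ds f (fst p) (snd p)) \<and>
           (\<forall>a b. (\<lambda>t. iterpd ds f t b) differentiable (at a) \<and>
                  (\<lambda>t. iterpd ds f a t) differentiable (at b)) \<and>
           (\<forall>k l :: nat. \<exists>C. \<forall>a b. \<bar>a\<bar> ^ k * \<bar>b\<bar> ^ l * cmod (iterpd ds f a b) \<le> C))"

definition A_S :: "(real \<Rightarrow> real \<Rightarrow> complex) set" where
  "A_S = {f. schwartz f \<and> (\<exists>K. \<forall>a b. K < \<bar>a\<bar> \<longrightarrow> f a b = 0)}"

definition piop :: "(real \<Rightarrow> real \<Rightarrow> complex) \<Rightarrow> (pt \<Rightarrow> complex) \<Rightarrow> pt \<Rightarrow> complex" where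
  "piop f \<xi> x = (case x of ((a, b), i) \<Rightarrow>
     complex_of_real (exp (- a)) *
     (LINT p|(lborel :: (real \<times> real) measure).
        f (fst p) (exp (- a) * snd p) * \<xi> ((a - fst p, b - snd p), i)))"

definition Thetaop :: "(pt \<Rightarrow> complex) \<Rightarrow> pt \<Rightarrow> complex" where
  "Thetaop \<xi> x = (case x of ((a, b), i) \<Rightarrow> complex_of_real (exp (- a)) * \<xi> x)"

text \<open>D^2 = (D_hat^2 + T^2) \<otimes> 1 is multiplication by this function.\<close>
definition Dsq :: "real \<Rightarrow> real \<Rightarrow> real \<Rightarrow> real \<Rightarrow> real" where
  "Dsq \<eta> \<omega> a b = (exp (- a) * b)\<^sup>2 + (\<eta> + \<omega> * exp (- a))\<^sup>2"

text \<open>(1 + D^2)^{-s/2}, by the functional calculus of the multiplication operator D^2\<close>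
definition resolv :: "real \<Rightarrow> real \<Rightarrow> real \<Rightarrow> (pt \<Rightarrow> complex) \<Rightarrow> pt \<Rightarrow> complex" where
  "resolv \<eta> \<omega> s \<xi> x = (case x of ((a, b), i) \<Rightarrow>
     complex_of_real ((1 + Dsq \<eta> \<omega> a b) powr (- s / 2)) * \<xi> x)"

end

(* With W the multiplication by exp (-a) (1 + D^2)^(-s/2), the operator is the product of
   \<pi>(f) W^(1/2) and W^(1/2) \<pi>(g).  Both factors are Hilbert-Schmidt: the b-integral in the
   squared norm of the kernel yields a factor exp a, the compact support of f and g makes the
   exponentials at a and a' comparable, and what remains is the integral of exp (-a) W, finite
   for s > 2.

   A product A B of Hilbert-Schmidt operators is shown to be nuclear without an orthonormal basis:
   the continuous kernel of B is an L^2-limit of kernels S_j that are step functions in the first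
   variable.  A (S_(j+1) - S_j) is a finite sum of rank-one operators whose nuclear norms add up to
   at most the product of the Hilbert-Schmidt norms of A and S_(j+1) - S_j, which is summable in j
   when S_j converges geometrically. *)

theory Submission
  imports Defs
begin

section \<open>Square-integrable functions\<close>

text \<open>\<open>trace_class\<close> asks for one sequence of rank-one terms whose partial sums
  converge along all N. The finite blocks of the telescoping sum therefore have to be enumerated in
  a single sequence, and a partial sum may stop in the middle of a block; what sticks out is
  controlled by the tail of the convergent series of nuclear norms.

  The weight has to be shared between the two factors: for f nonzero, the squared kernel norm of
  \<pi>(f) alone is a multiple of the integral of exp (-a) over R^2, which diverges. With W^(1/2) on
  each side, one full power of W appears in the squared norm of each factor.

  Integrals are total functions with value 0 on non-integrable arguments. Additivity of an integral
  operator is thus available only at those x for which row x of the kernel is square-integrable, and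
  identities between composed operators hold almost everywhere. That suffices, as they are compared
  in L^2 norm only.\<close>

definition square_integrable :: "'a measure \<Rightarrow> ('a \<Rightarrow> complex) \<Rightarrow> bool" where
  "square_integrable M u \<longleftrightarrow> u \<in> borel_measurable M \<and> integrable M (\<lambda>x. (cmod (u x))\<^sup>2)"

text \<open>Off L^2 the Bochner integral has the default value 0, and so has \<open>l2 M u\<close>.
  A bound on \<open>l2\<close> carries information only together with
  \<open>square_integrable\<close>, which is why most lemmas below establish both.\<close>

definition l2 :: "'a measure \<Rightarrow> ('a \<Rightarrow> complex) \<Rightarrow> real" where
  "l2 M u = sqrt (LINT x|M. (cmod (u x))\<^sup>2)"

lemma square_integrable_measurable [measurable_dest]:
  "square_integrable M u \<Longrightarrow> u \<in> borel_measurable M"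
  by (simp add: square_integrable_def)

lemma l2_nonneg [simp]: "0 \<le> l2 M u"
  by (simp add: l2_def)

lemma l2_square: "(l2 M u)\<^sup>2 = (LINT x|M. (cmod (u x))\<^sup>2)"
  by (simp add: l2_def)

lemma square_integrableI:
  assumes "u \<in> borel_measurable M" "(\<integral>\<^sup>+x. ennreal ((cmod (u x))\<^sup>2) \<partial>M) < \<infinity>"
  shows "square_integrable M u"
  unfolding square_integrable_def
proof
  show "u \<in> borel_measurable M" by fact
  note [measurable] = this
  show "integrable M (\<lambda>x. (cmod (u x))\<^sup>2)"
    by (rule integrableI_bounded) (use assms in auto)
qed

lemma nn_integral_square:
  assumes "square_integrable M u"
  shows "(\<integral>\<^sup>+x. ennreal ((cmod (u x))\<^sup>2) \<partial>M) = ennreal ((l2 M u)\<^sup>2)"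
  using assms by (simp add: square_integrable_def l2_square nn_integral_eq_integral)

lemma l2_le:
  assumes "square_integrable M u" "(\<integral>\<^sup>+x. ennreal ((cmod (u x))\<^sup>2) \<partial>M) \<le> ennreal (c\<^sup>2)" "0 \<le> c"
  shows "l2 M u \<le> c"
proof -
  have "(l2 M u)\<^sup>2 \<le> c\<^sup>2"
    using assms by (simp add: nn_integral_square)
  with assms(3) show ?thesis
    using power2_le_imp_le by blast
qed

lemma square_integrable_0 [simp]: "square_integrable M (\<lambda>x. 0)"
  by (simp add: square_integrable_def)

lemma l2_0 [simp]: "l2 M (\<lambda>x. 0) = 0"
  by (simp add: l2_def)

lemma square_integrable_cnj: "square_integrable M u \<Longrightarrow> square_integrable M (\<lambda>x. cnj (u x))"
  by (simp add: square_integrable_def borel_measurable_continuous_on[where f=cnj] continuous_intros)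

lemma l2_cnj [simp]: "l2 M (\<lambda>x. cnj (u x)) = l2 M u"
  by (simp add: l2_def)

lemma square_integrable_cmult: "square_integrable M u \<Longrightarrow> square_integrable M (\<lambda>x. c * u x)"
  by (auto simp: square_integrable_def norm_mult power_mult_distrib)

lemma l2_cmult [simp]: "l2 M (\<lambda>x. c * u x) = cmod c * l2 M u"
  by (simp add: l2_def norm_mult power_mult_distrib real_sqrt_mult)

lemma l2_cong_AE:
  assumes "u \<in> borel_measurable M" "v \<in> borel_measurable M" "AE x in M. u x = v x"
  shows "l2 M u = l2 M v"
proof -
  have "(LINT x|M. (cmod (u x))\<^sup>2) = (LINT x|M. (cmod (v x))\<^sup>2)"
    using assms by (intro integral_cong_AE) auto
  then show ?thesis by (simp add: l2_def)
qed

lemma square_integrable_bound: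
  assumes "square_integrable M v" "u \<in> borel_measurable M" "\<And>x. cmod (u x) \<le> cmod (v x)"
  shows "square_integrable M u" "l2 M u \<le> l2 M v"
proof -
  have le: "(cmod (u x))\<^sup>2 \<le> (cmod (v x))\<^sup>2" for x
    using assms(3) by (simp add: power_mono)
  show u: "square_integrable M u"
    unfolding square_integrable_def
  proof
    show "integrable M (\<lambda>x. (cmod (u x))\<^sup>2)"
      by (rule Bochner_Integration.integrable_bound[of _ "\<lambda>x. (cmod (v x))\<^sup>2"])
        (use assms le in \<open>auto simp: square_integrable_def\<close>)
  qed fact
  show "l2 M u \<le> l2 M v"
    unfolding l2_def real_sqrt_le_iff
    by (rule integral_mono) (use u assms(1) le in \<open>auto simp: square_integrable_def\<close>)
qed

lemma ennreal_square_le: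
  fixes a :: ennreal
  assumes "a\<^sup>2 \<le> (ennreal r)\<^sup>2" "0 \<le> r"
  shows "a \<le> ennreal r"
proof (cases a)
  case (real x)
  then have "x\<^sup>2 \<le> r\<^sup>2" using assms by (simp add: ennreal_power)
  then have "x \<le> r" using assms(2) by (rule power2_le_imp_le)
  then show ?thesis using real by (simp add: ennreal_leI)
next
  case top
  have "top = a\<^sup>2" by (simp add: top power2_eq_square)
  also have "\<dots> \<le> ennreal (r\<^sup>2)" using assms by (simp add: ennreal_power)
  finally show ?thesis by (simp add: top_unique)
qed

text \<open>The pairing is bilinear, without conjugation, because it is applied to kernels; inner
  products are reached through \<open>square_integrable_cnj\<close>. Starting from the inequality
  for nonnegative integrals yields integrability and the bound together.\<close>

lemma Cauchy_Schwarz_l2: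
  assumes u: "square_integrable M u" and v: "square_integrable M v"
  shows "integrable M (\<lambda>x. u x * v x)"
    and "(LINT x|M. cmod (u x) * cmod (v x)) \<le> l2 M u * l2 M v"
    and "cmod (LINT x|M. u x * v x) \<le> l2 M u * l2 M v"
proof -
  note [measurable] = u[THEN square_integrable_measurable] v[THEN square_integrable_measurable]
  have "(\<integral>\<^sup>+x. ennreal (cmod (u x)) * ennreal (cmod (v x)) \<partial>M)\<^sup>2
      \<le> (\<integral>\<^sup>+x. ennreal (cmod (u x)) ^ 2 \<partial>M) * (\<integral>\<^sup>+x. ennreal (cmod (v x)) ^ 2 \<partial>M)"
    by (rule Cauchy_Schwarz_nn_integral) auto
  also have "\<dots> = ennreal ((l2 M u * l2 M v)\<^sup>2)"
    using u v by (simp add: nn_integral_square ennreal_power power_mult_distrib ennreal_mult)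
  also have "\<dots> = (ennreal (l2 M u * l2 M v))\<^sup>2"
    by (simp add: ennreal_power)
  finally have "(\<integral>\<^sup>+x. ennreal (cmod (u x) * cmod (v x)) \<partial>M)\<^sup>2 \<le> (ennreal (l2 M u * l2 M v))\<^sup>2"
    by (simp only: ennreal_mult norm_ge_zero)
  then have le: "(\<integral>\<^sup>+x. ennreal (cmod (u x) * cmod (v x)) \<partial>M) \<le> ennreal (l2 M u * l2 M v)"
    by (rule ennreal_square_le) simp
  also have "\<dots> < \<infinity>" by simp
  finally show int: "integrable M (\<lambda>x. u x * v x)"
    by (intro integrableI_bounded) (auto simp: norm_mult)
  have int': "integrable M (\<lambda>x. cmod (u x) * cmod (v x))"
    using integrable_norm[OF int] by (simp add: norm_mult)
  show le': "(LINT x|M. cmod (u x) * cmod (v x)) \<le> l2 M u * l2 M v"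
    using le int' by (simp add: nn_integral_eq_integral)
  have "cmod (LINT x|M. u x * v x) \<le> (LINT x|M. cmod (u x * v x))"
    by (rule integral_norm_bound)
  with le' show "cmod (LINT x|M. u x * v x) \<le> l2 M u * l2 M v"
    by (simp add: norm_mult)
qed

lemma square_integrable_add:
  assumes u: "square_integrable M u" and v: "square_integrable M v"
  shows "square_integrable M (\<lambda>x. u x + v x)"
    and "l2 M (\<lambda>x. u x + v x) \<le> l2 M u + l2 M v"
proof -
  note [measurable] = u[THEN square_integrable_measurable] v[THEN square_integrable_measurable]
  have iu: "integrable M (\<lambda>x. (cmod (u x))\<^sup>2)" and iv: "integrable M (\<lambda>x. (cmod (v x))\<^sup>2)"
    using u v by (auto simp: square_integrable_def)
  have iuv: "integrable M (\<lambda>x. cmod (u x) * cmod (v x))"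
    using integrable_norm[OF Cauchy_Schwarz_l2(1)[OF u v]] by (simp add: norm_mult)
  \<comment> \<open>The expansion of (|u| + |v|)^2: it dominates the integrand, and its integral is
    at most the square of the sum of the norms.\<close>
  let ?w = "\<lambda>x. (cmod (u x))\<^sup>2 + 2 * (cmod (u x) * cmod (v x)) + (cmod (v x))\<^sup>2"
  have iw: "integrable M ?w"
    using iu iv iuv by auto
  have le: "(cmod (u x + v x))\<^sup>2 \<le> ?w x" for x
  proof -
    have "(cmod (u x + v x))\<^sup>2 \<le> (cmod (u x) + cmod (v x))\<^sup>2"
      by (intro power_mono norm_triangle_ineq) auto
    then show ?thesis by (simp add: power2_sum)
  qed
  have nonneg: "0 \<le> ?w x" for x by simp
  have i: "integrable M (\<lambda>x. (cmod (u x + v x))\<^sup>2)"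
    by (rule Bochner_Integration.integrable_bound[OF iw])
      (use le nonneg in \<open>auto intro!: AE_I2 order_trans[OF le]\<close>)
  then show "square_integrable M (\<lambda>x. u x + v x)"
    by (simp add: square_integrable_def)
  have "(l2 M (\<lambda>x. u x + v x))\<^sup>2 \<le> (LINT x|M. ?w x)"
    unfolding l2_square by (rule integral_mono) (use i iw le in auto)
  also have "\<dots> = (l2 M u)\<^sup>2 + 2 * (LINT x|M. cmod (u x) * cmod (v x)) + (l2 M v)\<^sup>2"
    using iu iv iuv by (simp add: l2_square)
  also have "\<dots> \<le> (l2 M u + l2 M v)\<^sup>2"
    using Cauchy_Schwarz_l2(2)[OF u v] by (simp add: power2_sum)
  finally show "l2 M (\<lambda>x. u x + v x) \<le> l2 M u + l2 M v"
    by (rule power2_le_imp_le) simp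
qed

lemma square_integrable_diff:
  assumes u: "square_integrable M u" and v: "square_integrable M v"
  shows "square_integrable M (\<lambda>x. u x - v x)"
    and "l2 M (\<lambda>x. u x - v x) \<le> l2 M u + l2 M v"
  using square_integrable_add[OF u square_integrable_cmult[OF v, of "-1"]] l2_cmult[of M "-1" v]
  by auto

lemma square_integrable_sum:
  assumes "finite F" "\<And>i. i \<in> F \<Longrightarrow> square_integrable M (u i)"
  shows "square_integrable M (\<lambda>x. \<Sum>i\<in>F. u i x)"
    and "l2 M (\<lambda>x. \<Sum>i\<in>F. u i x) \<le> (\<Sum>i\<in>F. l2 M (u i))"
proof -
  have "square_integrable M (\<lambda>x. \<Sum>i\<in>F. u i x) \<and> l2 M (\<lambda>x. \<Sum>i\<in>F. u i x) \<le> (\<Sum>i\<in>F. l2 M (u i))"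
    using assms
  proof (induction F rule: finite_induct)
    case (insert i F)
    then have "square_integrable M (u i)" "square_integrable M (\<lambda>x. \<Sum>i\<in>F. u i x)"
      and le: "l2 M (\<lambda>x. \<Sum>i\<in>F. u i x) \<le> (\<Sum>i\<in>F. l2 M (u i))"
      by auto
    from square_integrable_add[OF this(1,2)] le insert.hyps show ?case
      by auto
  qed simp
  then show "square_integrable M (\<lambda>x. \<Sum>i\<in>F. u i x)"
    and "l2 M (\<lambda>x. \<Sum>i\<in>F. u i x) \<le> (\<Sum>i\<in>F. l2 M (u i))" by auto
qed

section \<open>Hilbert-Schmidt integral operators\<close>

lemma nn_integral_lborel_pair:
  fixes f :: "'a::euclidean_space \<times> 'b::euclidean_space \<Rightarrow> ennreal"
  assumes "f \<in> borel_measurable borel"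
  shows "(\<integral>\<^sup>+p. f p \<partial>lborel) = (\<integral>\<^sup>+x. \<integral>\<^sup>+y. f (x, y) \<partial>lborel \<partial>lborel)"
    and "(\<integral>\<^sup>+p. f p \<partial>lborel) = (\<integral>\<^sup>+y. \<integral>\<^sup>+x. f (x, y) \<partial>lborel \<partial>lborel)"
proof -
  have m [measurable]: "f \<in> borel_measurable (lborel \<Otimes>\<^sub>M lborel)"
    unfolding lborel_prod using assms by simp
  show 1: "(\<integral>\<^sup>+p. f p \<partial>lborel) = (\<integral>\<^sup>+x. \<integral>\<^sup>+y. f (x, y) \<partial>lborel \<partial>lborel)"
    using lborel.nn_integral_fst[OF m] by (simp add: lborel_prod)
  show "(\<integral>\<^sup>+p. f p \<partial>lborel) = (\<integral>\<^sup>+y. \<integral>\<^sup>+x. f (x, y) \<partial>lborel \<partial>lborel)"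
    unfolding 1 by (rule lborel_pair.Fubini[symmetric]) simp
qed

definition kernel_op ::
    "('a::euclidean_space \<times> 'b::euclidean_space \<Rightarrow> complex) \<Rightarrow> ('b \<Rightarrow> complex) \<Rightarrow> 'a \<Rightarrow> complex" where
  "kernel_op K \<xi> x = (LINT y|lborel. K (x, y) * \<xi> y)"

text \<open>By Tonelli the squared row norms have a finite integral. The exceptional rows are the
  source of the \<open>AE\<close> in the operator identities below: there the integral defining
  \<open>kernel_op\<close> may fall back to its default value.\<close>

lemma AE_square_integrable_section:
  fixes K :: "'a::euclidean_space \<times> 'b::euclidean_space \<Rightarrow> complex"
  assumes K: "square_integrable lborel K"
  shows "AE x in lborel. square_integrable lborel (\<lambda>y. K (x, y))"
proof -
  have [measurable]: "K \<in> borel_measurable borel"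
    using square_integrable_measurable[OF K] by simp
  have m: "(\<lambda>y. K (x, y)) \<in> borel_measurable lborel" for x
    by measurable
  have "(\<integral>\<^sup>+x. \<integral>\<^sup>+y. ennreal ((cmod (K (x, y)))\<^sup>2) \<partial>lborel \<partial>lborel) \<noteq> \<infinity>"
    using nn_integral_square[OF K] by (subst (asm) nn_integral_lborel_pair(1)) auto
  then have "AE x in lborel. (\<integral>\<^sup>+y. ennreal ((cmod (K (x, y)))\<^sup>2) \<partial>lborel) \<noteq> \<infinity>"
    by (rule nn_integral_noteq_infinite[rotated]) measurable
  then show ?thesis
    by eventually_elim (use m in \<open>auto intro!: square_integrableI simp: top.not_eq_extremum\<close>)
qed

lemma measurable_kernel_op:
  fixes K :: "'a::euclidean_space \<times> 'b::euclidean_space \<Rightarrow> complex"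
  assumes [measurable]: "K \<in> borel_measurable borel" "\<xi> \<in> borel_measurable borel"
  shows "kernel_op K \<xi> \<in> borel_measurable borel"
proof -
  have "(\<lambda>x. LINT y|lborel. K (x, y) * \<xi> y) \<in> borel_measurable borel"
    by measurable
  then show ?thesis by (simp add: kernel_op_def[abs_def])
qed

text \<open>Cauchy-Schwarz in each row bounds the squared value at x by the squared row norm times
  that of \<xi>; integrating over x assembles the row norms into the norm of K.\<close>

lemma kernel_op_Hilbert_Schmidt:
  fixes K :: "'a::euclidean_space \<times> 'b::euclidean_space \<Rightarrow> complex"
  assumes K: "square_integrable lborel K" and \<xi>: "square_integrable lborel \<xi>"
  shows "square_integrable lborel (kernel_op K \<xi>)"
    and "l2 lborel (kernel_op K \<xi>) \<le> l2 lborel K * l2 lborel \<xi>"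
proof -
  have [measurable]: "K \<in> borel_measurable borel" "\<xi> \<in> borel_measurable borel"
    using square_integrable_measurable[OF K] square_integrable_measurable[OF \<xi>] by auto
  note [measurable] = measurable_kernel_op
  have "AE x in lborel. ennreal ((cmod (kernel_op K \<xi> x))\<^sup>2) \<le>
    (\<integral>\<^sup>+y. ennreal ((cmod (K (x, y)))\<^sup>2) \<partial>lborel) * ennreal ((l2 lborel \<xi>)\<^sup>2)"
    using AE_square_integrable_section[OF K]
  proof eventually_elim
    case (elim x)
    have "cmod (kernel_op K \<xi> x) \<le> l2 lborel (\<lambda>y. K (x, y)) * l2 lborel \<xi>"
      unfolding kernel_op_def by (rule Cauchy_Schwarz_l2(3)[OF elim \<xi>])
    then have "(cmod (kernel_op K \<xi> x))\<^sup>2 \<le> (l2 lborel (\<lambda>y. K (x, y)))\<^sup>2 * (l2 lborel \<xi>)\<^sup>2"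
      unfolding power_mult_distrib[symmetric] by (rule power_mono) simp
    then show ?case
      by (simp add: nn_integral_square[OF elim] flip: ennreal_mult)
  qed
  then have "(\<integral>\<^sup>+x. ennreal ((cmod (kernel_op K \<xi> x))\<^sup>2) \<partial>lborel) \<le>
    (\<integral>\<^sup>+x. (\<integral>\<^sup>+y. ennreal ((cmod (K (x, y)))\<^sup>2) \<partial>lborel) * ennreal ((l2 lborel \<xi>)\<^sup>2) \<partial>lborel)"
    by (rule nn_integral_mono_AE)
  also have "\<dots> = (\<integral>\<^sup>+x. \<integral>\<^sup>+y. ennreal ((cmod (K (x, y)))\<^sup>2) \<partial>lborel \<partial>lborel) * ennreal ((l2 lborel \<xi>)\<^sup>2)"
    by (rule nn_integral_multc) measurable
  also have "\<dots> = ennreal ((l2 lborel K)\<^sup>2) * ennreal ((l2 lborel \<xi>)\<^sup>2)"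
    by (subst nn_integral_square[OF K, symmetric], subst nn_integral_lborel_pair(1)) auto
  finally have le: "(\<integral>\<^sup>+x. ennreal ((cmod (kernel_op K \<xi> x))\<^sup>2) \<partial>lborel) \<le>
      ennreal ((l2 lborel K * l2 lborel \<xi>)\<^sup>2)"
    by (simp add: power_mult_distrib ennreal_mult)
  show sq: "square_integrable lborel (kernel_op K \<xi>)"
    by (rule square_integrableI) (use le in \<open>auto intro: le_less_trans\<close>)
  show "l2 lborel (kernel_op K \<xi>) \<le> l2 lborel K * l2 lborel \<xi>"
    by (rule l2_le[OF sq le]) simp
qed

section \<open>Kernels that are step functions in the first variable\<close>

lemma square_integrable_indicator:
  assumes "E \<in> sets M" "emeasure M E < \<infinity>"
  shows "square_integrable M (indicator E)"
    and "l2 M (indicator E) = sqrt (measure M E)"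
proof -
  have eq: "(cmod (indicator E x))\<^sup>2 = indicator E x" for x
    by (auto simp: indicator_def)
  show "square_integrable M (indicator E)"
    unfolding square_integrable_def eq using assms by auto
  show "l2 M (indicator E) = sqrt (measure M E)"
    unfolding l2_def eq using assms by (simp add: sets.Int_space_eq2)
qed

lemma l2_tensor:
  fixes b :: "'b::euclidean_space \<Rightarrow> complex" and E :: "'a::euclidean_space set"
  assumes E: "E \<in> sets borel" "emeasure lborel E < \<infinity>" and b: "square_integrable lborel b"
  defines "K \<equiv> \<lambda>p. indicator E (fst p) * b (snd p)"
  shows "square_integrable lborel K"
    and "l2 lborel K = sqrt (measure lborel E) * l2 lborel b"
proof -
  have [measurable]: "b \<in> borel_measurable borel" "E \<in> sets borel"
    using square_integrable_measurable[OF b] E by auto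
  have m: "K \<in> borel_measurable borel"
    unfolding K_def borel_prod[symmetric] by measurable
  have m': "(\<lambda>p. ennreal ((cmod (K p))\<^sup>2)) \<in> borel_measurable borel"
    using m by measurable
  have "(\<integral>\<^sup>+p. ennreal ((cmod (K p))\<^sup>2) \<partial>lborel)
      = (\<integral>\<^sup>+y. \<integral>\<^sup>+z. indicator E y * ennreal ((cmod (b z))\<^sup>2) \<partial>lborel \<partial>lborel)"
    unfolding nn_integral_lborel_pair(1)[OF m']
    by (intro nn_integral_cong) (auto simp: K_def indicator_def)
  also have "\<dots> = (\<integral>\<^sup>+y. ennreal ((l2 lborel b)\<^sup>2) * indicator E y \<partial>lborel)"
    using nn_integral_square[OF b] by (intro nn_integral_cong) (simp add: nn_integral_cmult mult.commute)
  also have "\<dots> = ennreal ((l2 lborel b)\<^sup>2) * emeasure lborel E"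
    by (simp add: nn_integral_cmult_indicator)
  also have "\<dots> = ennreal ((sqrt (measure lborel E) * l2 lborel b)\<^sup>2)"
    using E(2) by (simp add: emeasure_eq_ennreal_measure power_mult_distrib mult.commute flip: ennreal_mult)
  finally have eq: "(\<integral>\<^sup>+p. ennreal ((cmod (K p))\<^sup>2) \<partial>lborel) = \<dots>" .
  show sq: "square_integrable lborel K"
    by (rule square_integrableI) (use eq m in auto)
  then have "(l2 lborel K)\<^sup>2 = (sqrt (measure lborel E) * l2 lborel b)\<^sup>2"
    using eq by (simp add: nn_integral_square)
  then show "l2 lborel K = sqrt (measure lborel E) * l2 lborel b"
    by (simp add: power2_eq_iff_nonneg)
qed

text \<open>Pythagoras for restrictions to disjoint sets, an inequality because the sets need not
  cover the space. It is applied to strips of columns of one kernel and to strips of rows of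
  another.\<close>

lemma sum_l2_restrict_le:
  assumes K: "square_integrable M K" and "finite I"
    and E: "\<And>i. i \<in> I \<Longrightarrow> E i \<in> sets M" and disj: "disjoint_family_on E I"
  shows "(\<Sum>i\<in>I. (l2 M (\<lambda>p. indicator (E i) p * K p))\<^sup>2) \<le> (l2 M K)\<^sup>2"
proof -
  have K2: "integrable M (\<lambda>p. (cmod (K p))\<^sup>2)"
    using K by (simp add: square_integrable_def)
  have i: "integrable M (\<lambda>p. indicator (E i) p * (cmod (K p))\<^sup>2)" if "i \<in> I" for i
    using integrable_mult_indicator[OF E[OF that] K2] by simp
  have "(\<Sum>i\<in>I. (l2 M (\<lambda>p. indicator (E i) p * K p))\<^sup>2)
      = (\<Sum>i\<in>I. LINT p|M. indicator (E i) p * (cmod (K p))\<^sup>2)"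
    unfolding l2_square
    by (intro sum.cong refl Bochner_Integration.integral_cong) (auto simp: indicator_def)
  also have "\<dots> = (LINT p|M. (\<Sum>i\<in>I. indicator (E i) p * (cmod (K p))\<^sup>2))"
    using i by simp
  also have "\<dots> \<le> (LINT p|M. (cmod (K p))\<^sup>2)"
  proof (rule integral_mono)
    fix p
    have "(\<Sum>i\<in>I. indicator (E i) p) = (indicator (\<Union>i\<in>I. E i) p :: real)"
      using disj \<open>finite I\<close> by (simp add: indicator_UN_disjoint)
    also have "\<dots> \<le> 1" by (simp add: indicator_def)
    finally have "(\<Sum>i\<in>I. indicator (E i) p) * (cmod (K p))\<^sup>2 \<le> 1 * (cmod (K p))\<^sup>2"
      by (intro mult_right_mono) auto
    then show "(\<Sum>i\<in>I. indicator (E i) p * (cmod (K p))\<^sup>2) \<le> (cmod (K p))\<^sup>2"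
      by (simp add: sum_distrib_right)
  qed (use i K2 in auto)
  finally show ?thesis by (simp add: l2_square)
qed

text \<open>The pair (c, b) encodes the kernel (y, z) \<mapsto> b (c y) z.  The cell of index 0 is the only one
  that may have infinite measure, and the kernel vanishes on it.\<close>

definition step_data ::
    "('a::euclidean_space \<Rightarrow> nat) \<Rightarrow> (nat \<Rightarrow> 'b::euclidean_space \<Rightarrow> complex) \<Rightarrow> bool" where
  "step_data c b \<longleftrightarrow> c \<in> measurable borel (count_space UNIV) \<and> finite (range c) \<and>
     b 0 = (\<lambda>z. 0) \<and> (\<forall>k. square_integrable lborel (b k)) \<and>
     (\<forall>k. k \<noteq> 0 \<longrightarrow> emeasure lborel (c -` {k}) < \<infinity>)"

definition step_kernel ::
    "('a::euclidean_space \<Rightarrow> nat) \<Rightarrow> (nat \<Rightarrow> 'b::euclidean_space \<Rightarrow> complex) \<Rightarrow> 'a \<times> 'b \<Rightarrow> complex" where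
  "step_kernel c b p = b (c (fst p)) (snd p)"

lemma step_data_cell_measurable: "step_data c b \<Longrightarrow> c -` {k} \<in> sets borel"
  using measurable_sets[of c borel "count_space UNIV" "{k}"] by (simp add: step_data_def)

lemma step_kernel_sum:
  assumes "step_data c b"
  shows "step_kernel c b p = (\<Sum>k\<in>range c - {0}. indicator (c -` {k}) (fst p) * b k (snd p))"
proof -
  have fin: "finite (range c - {0})" and b0: "b 0 = (\<lambda>z. 0)"
    using assms by (auto simp: step_data_def)
  have "(\<Sum>k\<in>range c - {0}. indicator (c -` {k}) (fst p) * b k (snd p))
      = (\<Sum>k\<in>range c - {0}. if k = c (fst p) then b k (snd p) else 0)"
    by (intro sum.cong) (auto simp: indicator_def)
  also have "\<dots> = b (c (fst p)) (snd p)"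
    using fin b0 by (simp add: sum.delta)
  finally show ?thesis by (simp add: step_kernel_def)
qed

lemma square_integrable_step_kernel:
  assumes "step_data c b"
  shows "square_integrable lborel (step_kernel c b)"
proof -
  have "square_integrable lborel
      (\<lambda>p. \<Sum>k\<in>range c - {0}. indicator (c -` {k}) (fst p) * b k (snd p))"
    using assms step_data_cell_measurable[OF assms]
    by (intro square_integrable_sum(1) l2_tensor(1)) (auto simp: step_data_def)
  then show ?thesis
    by (simp add: step_kernel_sum[OF assms, abs_def])
qed

lemma step_data_zero: "step_data (\<lambda>y. 0) (\<lambda>k z. 0)"
  by (simp add: step_data_def)

text \<open>The common refinement of the two partitions, with the pair of cell indices coded by
  \<open>prod_encode\<close>. The code of (0, 0) is 0, so the distinguished cell of the refinement
  is the intersection of the two distinguished ones; every other cell lies in a cell of finite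
  measure of one of the partitions.\<close>

lemma step_data_diff:
  assumes 1: "step_data c b" and 2: "step_data c' b'"
  defines "c'' \<equiv> \<lambda>y. prod_encode (c y, c' y)"
    and "b'' \<equiv> \<lambda>m z. b (fst (prod_decode m)) z - b' (snd (prod_decode m)) z"
  shows "step_data c'' b''"
    and "step_kernel c'' b'' p = step_kernel c b p - step_kernel c' b' p"
proof -
  show "step_kernel c'' b'' p = step_kernel c b p - step_kernel c' b' p"
    by (simp add: step_kernel_def c''_def b''_def)
  have [measurable]: "c \<in> measurable borel (count_space UNIV)" "c' \<in> measurable borel (count_space UNIV)"
    using 1 2 by (auto simp: step_data_def)
  have m: "c'' \<in> measurable borel (count_space UNIV)"
    unfolding c''_def by measurable
  have "range c'' \<subseteq> prod_encode ` (range c \<times> range c')"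
    by (auto simp: c''_def)
  moreover have "finite (range c \<times> range c')"
    using 1 2 by (auto simp: step_data_def)
  ultimately have fin: "finite (range c'')"
    using finite_surj by blast
  have "prod_decode 0 = (0, 0)"
    by (simp add: prod_decode_def prod_decode_aux.simps)
  then have z: "b'' 0 = (\<lambda>z. 0)"
    using 1 2 by (simp add: b''_def step_data_def)
  have sq: "square_integrable lborel (b'' k)" for k
    using 1 2 unfolding b''_def step_data_def by (intro square_integrable_diff(1)) auto
  have "emeasure lborel (c'' -` {m}) < \<infinity>" if "m \<noteq> 0" for m
  proof -
    obtain k l where m: "m = prod_encode (k, l)"
      by (metis prod_decode_inverse surj_pair)
    have "prod_encode (0, 0) = 0"
      by (simp add: prod_encode_def)
    with m that have "k \<noteq> 0 \<or> l \<noteq> 0" by metis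
    then show ?thesis
    proof
      assume "k \<noteq> 0"
      have "emeasure lborel (c'' -` {m}) \<le> emeasure lborel (c -` {k})"
        using step_data_cell_measurable[OF 1] by (intro emeasure_mono) (auto simp: c''_def m)
      then show ?thesis using 1 \<open>k \<noteq> 0\<close> unfolding step_data_def by (auto intro: le_less_trans)
    next
      assume "l \<noteq> 0"
      have "emeasure lborel (c'' -` {m}) \<le> emeasure lborel (c' -` {l})"
        using step_data_cell_measurable[OF 2] by (intro emeasure_mono) (auto simp: c''_def m)
      then show ?thesis using 2 \<open>l \<noteq> 0\<close> unfolding step_data_def by (auto intro: le_less_trans)
    qed
  qed
  with m fin z sq show "step_data c'' b''"
    by (simp add: step_data_def)
qed

text \<open>The step kernel sends \<xi> to a combination of finitely many cell indicators, and this
  inner identity holds at every y. Applying A afterwards needs additivity of the integral, hence a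
  square-integrable row of A at x.\<close>

lemma kernel_op_step_kernel:
  fixes A :: "'a::euclidean_space \<times> 'b::euclidean_space \<Rightarrow> complex"
    and b :: "nat \<Rightarrow> 'c::euclidean_space \<Rightarrow> complex"
  assumes A: "square_integrable lborel A" and cb: "step_data c b"
    and \<xi>: "square_integrable lborel \<xi>"
  shows "AE x in lborel. kernel_op A (kernel_op (step_kernel c b) \<xi>) x =
    (\<Sum>k\<in>range c - {0}. (LINT z|lborel. b k z * \<xi> z) * kernel_op A (indicator (c -` {k})) x)"
  using AE_square_integrable_section[OF A]
proof eventually_elim
  case (elim x)
  have ind: "square_integrable lborel (indicator (c -` {k}) :: 'b \<Rightarrow> complex)" if "k \<noteq> 0" for k
    using cb that step_data_cell_measurable[OF cb]
    by (intro square_integrable_indicator) (auto simp: step_data_def)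
  define \<beta> where "\<beta> k = (LINT z|lborel. b k z * \<xi> z)" for k
  have op: "kernel_op (step_kernel c b) \<xi> y = (\<Sum>k\<in>range c - {0}. \<beta> k * indicator (c -` {k}) y)" for y
  proof -
    have "kernel_op (step_kernel c b) \<xi> y = \<beta> (c y)"
      by (simp add: kernel_op_def step_kernel_def \<beta>_def)
    \<comment> \<open>If \<open>c y\<close> is 0, no index matches and the sum is 0; so is
      \<open>\<beta> 0\<close>, because \<open>b 0\<close> vanishes.\<close>
    also have "\<dots> = (\<Sum>k\<in>range c - {0}. if k = c y then \<beta> k else 0)"
      using cb by (auto simp: step_data_def \<beta>_def sum.delta)
    also have "\<dots> = (\<Sum>k\<in>range c - {0}. \<beta> k * indicator (c -` {k}) y)"
      by (intro sum.cong) (auto simp: indicator_def)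
    finally show ?thesis .
  qed
  have "kernel_op A (kernel_op (step_kernel c b) \<xi>) x
      = (LINT y|lborel. (\<Sum>k\<in>range c - {0}. \<beta> k * (A (x, y) * indicator (c -` {k}) y)))"
    unfolding kernel_op_def[of A] op
    by (intro Bochner_Integration.integral_cong) (auto simp: sum_distrib_left intro!: sum.cong)
  also have "\<dots> = (\<Sum>k\<in>range c - {0}. \<beta> k * kernel_op A (indicator (c -` {k})) x)"
  proof (subst Bochner_Integration.integral_sum)
    fix k assume "k \<in> range c - {0}"
    then have "square_integrable lborel (indicator (c -` {k}) :: 'b \<Rightarrow> complex)"
      by (auto intro: ind)
    from Cauchy_Schwarz_l2(1)[OF elim this]
    show "integrable lborel (\<lambda>y. \<beta> k * (A (x, y) * indicator (c -` {k}) y))" by simp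
  qed (simp add: kernel_op_def)
  finally show ?case by (simp add: \<beta>_def)
qed

text \<open>Cell k contributes one rank-one operator. Its norm is at most that of A on the columns
  over the cell, times the square root of the measure of the cell, times the norm of
  \<open>b k\<close>. The last two factors together are the norm of the step kernel on the rows over
  the cell, and Cauchy-Schwarz over k recombines the column strips and the row strips.\<close>

lemma nuclear_norm_step_kernel:
  fixes A :: "'a::euclidean_space \<times> 'b::euclidean_space \<Rightarrow> complex"
    and b :: "nat \<Rightarrow> 'c::euclidean_space \<Rightarrow> complex"
  assumes A: "square_integrable lborel A" and cb: "step_data c b"
  shows "(\<Sum>k\<in>range c - {0}. l2 lborel (b k) * l2 lborel (kernel_op A (indicator (c -` {k}))))
      \<le> l2 lborel A * l2 lborel (step_kernel c b)"
    and "k \<noteq> 0 \<Longrightarrow> square_integrable lborel (kernel_op A (indicator (c -` {k})))"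
proof -
  let ?E = "\<lambda>k. c -` {k}"
  let ?I = "range c - {0}"
  have fin: "finite ?I"
    using cb by (auto simp: step_data_def)
  have [measurable]: "A \<in> borel_measurable borel"
    using square_integrable_measurable[OF A] by simp
  have [measurable]: "?E k \<in> sets borel" for k
    by (rule step_data_cell_measurable[OF cb])
  define A' where "A' k = (\<lambda>p. indicator (UNIV \<times> ?E k) p * A p)" for k
  define D' where "D' k = (\<lambda>p. indicator (?E k \<times> UNIV) p * step_kernel c b p)" for k
  have A': "square_integrable lborel (A' k)" for k
  proof (rule square_integrable_bound(1)[OF A])
    have [measurable]: "UNIV \<times> ?E k \<in> sets (borel :: ('a \<times> 'b) measure)"
      by (intro borel_Times) auto
    show "A' k \<in> borel_measurable lborel"
      unfolding A'_def by measurable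
  qed (auto simp: A'_def indicator_def)
  have ind: "square_integrable lborel (indicator (?E k) :: 'b \<Rightarrow> complex)"
    "l2 lborel (indicator (?E k) :: 'b \<Rightarrow> complex) = sqrt (measure lborel (?E k))" if "k \<noteq> 0" for k
    using cb that by (auto simp: step_data_def intro!: square_integrable_indicator)
  \<comment> \<open>The image of an indicator sees only the columns over that cell. With the full
    norm of A in each summand, the sum over k would not be bounded independently of the number of
    cells.\<close>
  have v: "kernel_op A (indicator (?E k)) = kernel_op (A' k) (indicator (?E k))" for k
    unfolding kernel_op_def A'_def
    by (intro ext Bochner_Integration.integral_cong) (auto simp: indicator_def)
  show "k \<noteq> 0 \<Longrightarrow> square_integrable lborel (kernel_op A (indicator (?E k)))"
    unfolding v by (intro kernel_op_Hilbert_Schmidt A' ind)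
  have le: "l2 lborel (b k) * l2 lborel (kernel_op A (indicator (?E k))) \<le> l2 lborel (A' k) * l2 lborel (D' k)"
    if "k \<in> ?I" for k
  proof -
    have "k \<noteq> 0" using that by simp
    have "D' k = (\<lambda>p. indicator (?E k) (fst p) * b k (snd p))"
      by (auto simp: D'_def step_kernel_def indicator_def fun_eq_iff)
    then have D: "l2 lborel (D' k) = sqrt (measure lborel (?E k)) * l2 lborel (b k)"
      using cb \<open>k \<noteq> 0\<close> by (simp add: l2_tensor(2) step_data_def)
    have "l2 lborel (kernel_op A (indicator (?E k))) \<le> l2 lborel (A' k) * sqrt (measure lborel (?E k))"
      unfolding v using kernel_op_Hilbert_Schmidt(2)[OF A' ind(1)[OF \<open>k \<noteq> 0\<close>]] ind(2)[OF \<open>k \<noteq> 0\<close>]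
      by simp
    then have "l2 lborel (b k) * l2 lborel (kernel_op A (indicator (?E k)))
        \<le> l2 lborel (b k) * (l2 lborel (A' k) * sqrt (measure lborel (?E k)))"
      by (intro mult_left_mono) auto
    then show ?thesis by (simp add: D mult_ac)
  qed
  have disj: "disjoint_family_on (\<lambda>k. UNIV \<times> ?E k) ?I" "disjoint_family_on (\<lambda>k. ?E k \<times> UNIV) ?I"
    by (auto simp: disjoint_family_on_def)
  have "(\<Sum>k\<in>?I. l2 lborel (b k) * l2 lborel (kernel_op A (indicator (?E k))))
      \<le> (\<Sum>k\<in>?I. \<bar>l2 lborel (A' k)\<bar> * \<bar>l2 lborel (D' k)\<bar>)"
    using le by (intro sum_mono) simp
  also have "\<dots> \<le> L2_set (\<lambda>k. l2 lborel (A' k)) ?I * L2_set (\<lambda>k. l2 lborel (D' k)) ?I"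
    by (rule L2_set_mult_ineq)
  also have "\<dots> \<le> l2 lborel A * l2 lborel (step_kernel c b)"
  proof (intro mult_mono)
    show "L2_set (\<lambda>k. l2 lborel (A' k)) ?I \<le> l2 lborel A"
      unfolding L2_set_def A'_def
      by (intro real_le_lsqrt sum_l2_restrict_le A fin disj)
        (auto intro!: sum_nonneg borel_Times)
    show "L2_set (\<lambda>k. l2 lborel (D' k)) ?I \<le> l2 lborel (step_kernel c b)"
      unfolding L2_set_def D'_def
      by (intro real_le_lsqrt sum_l2_restrict_le square_integrable_step_kernel cb fin disj)
        (auto intro!: sum_nonneg borel_Times)
  qed (auto intro: L2_set_nonneg)
  finally show "(\<Sum>k\<in>?I. l2 lborel (b k) * l2 lborel (kernel_op A (indicator (?E k))))
      \<le> l2 lborel A * l2 lborel (step_kernel c b)" .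
qed

text \<open>Dominated convergence reduces B to a product of two balls. There B is uniformly
  continuous, so y may be replaced by a nearby point of a finite net. Only the first variable is
  discretised: the values of the step kernel are truncated sections of B at net points,
  square-integrable because B is bounded on the compact product.\<close>

lemma step_kernel_approximation:
  fixes B :: "'a::euclidean_space \<times> 'b::euclidean_space \<Rightarrow> complex"
  assumes cont: "continuous_on UNIV B" and B: "square_integrable lborel B" and "0 < \<epsilon>"
  shows "\<exists>c b. step_data c b \<and> l2 lborel (\<lambda>p. B p - step_kernel c b p) \<le> \<epsilon>"
proof -
  have [measurable]: "B \<in> borel_measurable borel"
    using square_integrable_measurable[OF B] by simp
  define S :: "nat \<Rightarrow> ('a \<times> 'b) set" where "S n = cball 0 (real n) \<times> cball 0 (real n)" for n
  have compact_S: "compact (S n)" for n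
    unfolding S_def by (intro compact_Times compact_cball)
  have S_sets [measurable]: "S n \<in> sets borel" for n
    using compact_S[of n] by (rule borel_compact)
  have S_fin: "emeasure lborel (S n) < \<infinity>" for n
    using compact_imp_bounded[OF compact_S[of n]] by (rule emeasure_bounded_finite)
  have "(\<lambda>n. LINT p|lborel. (cmod (B p - indicator (S n) p * B p))\<^sup>2) \<longlonglongrightarrow> (LINT p|(lborel :: ('a \<times> 'b) measure). 0)"
  proof (rule integral_dominated_convergence[where w="\<lambda>p. (cmod (B p))\<^sup>2"])
    show "integrable lborel (\<lambda>p. (cmod (B p))\<^sup>2)"
      using B by (simp add: square_integrable_def)
    show "AE p in lborel. (\<lambda>n. (cmod (B p - indicator (S n) p * B p))\<^sup>2) \<longlonglongrightarrow> 0"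
    proof (rule AE_I2)
      fix p :: "'a \<times> 'b"
      obtain N :: nat where N: "max (norm (fst p)) (norm (snd p)) \<le> real N"
        using real_arch_simple by blast
      have "p \<in> S n" if "n \<ge> N" for n
      proof -
        have "real N \<le> real n" using that by simp
        with N show ?thesis by (cases p) (auto simp: S_def)
      qed
      then have "\<forall>\<^sub>F n in sequentially. (cmod (B p - indicator (S n) p * B p))\<^sup>2 = 0"
        unfolding eventually_sequentially by (intro exI[of _ N]) (auto simp: indicator_def)
      then show "(\<lambda>n. (cmod (B p - indicator (S n) p * B p))\<^sup>2) \<longlonglongrightarrow> 0"
        by (rule tendsto_eventually)
    qed
    show "AE p in lborel. norm ((cmod (B p - indicator (S n) p * B p))\<^sup>2) \<le> (cmod (B p))\<^sup>2" for n
      by (intro AE_I2) (auto simp: indicator_def)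
  qed auto
  then have "(\<lambda>n. l2 lborel (\<lambda>p. B p - indicator (S n) p * B p)) \<longlonglongrightarrow> 0"
    unfolding l2_def using tendsto_real_sqrt by force
  then have "\<forall>\<^sub>F n in sequentially. l2 lborel (\<lambda>p. B p - indicator (S n) p * B p) < \<epsilon> / 2"
    using \<open>0 < \<epsilon>\<close> by (intro order_tendstoD(2)) auto
  then obtain n where n: "l2 lborel (\<lambda>p. B p - indicator (S n) p * B p) < \<epsilon> / 2"
    unfolding eventually_sequentially by blast
  define Q :: "'a set" where "Q = cball 0 (real n)"
  define Q' :: "'b set" where "Q' = cball 0 (real n)"
  have SQ: "S n = Q \<times> Q'" by (simp add: S_def Q_def Q'_def)
  have [measurable]: "Q \<in> sets borel" "Q' \<in> sets borel" by (auto simp: Q_def Q'_def)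
  \<comment> \<open>A uniform error \<epsilon>' on \<open>S n\<close> costs at most \<epsilon>'
    times the square root of its measure, which must stay below \<epsilon> / 2. The summand 1 guards
    against measure 0.\<close>
  define \<epsilon>' where "\<epsilon>' = \<epsilon> / (2 * (sqrt (measure lborel (S n)) + 1))"
  have sq_pos: "0 < sqrt (measure lborel (S n)) + 1"
    by (intro add_nonneg_pos) auto
  then have "0 < \<epsilon>'" using \<open>0 < \<epsilon>\<close> by (simp add: \<epsilon>'_def)
  have "uniformly_continuous_on (S n) B"
    using compact_S cont by (intro compact_uniformly_continuous) (auto intro: continuous_on_subset)
  then obtain \<delta> where "0 < \<delta>"
    and \<delta>: "\<And>p q. p \<in> S n \<Longrightarrow> q \<in> S n \<Longrightarrow> dist p q < \<delta> \<Longrightarrow> dist (B p) (B q) < \<epsilon>'"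
    unfolding uniformly_continuous_on_def using \<open>0 < \<epsilon>'\<close> by metis
  have "compact Q" by (simp add: Q_def)
  then obtain X where X: "finite X" "X \<subseteq> Q" "Q \<subseteq> (\<Union>x\<in>X. ball x \<delta>)"
  proof (rule compactE_image[of Q Q "\<lambda>x. ball x \<delta>"])
    show "Q \<subseteq> (\<Union>x\<in>Q. ball x \<delta>)" using \<open>0 < \<delta>\<close> by auto
  qed auto
  from \<open>finite X\<close> obtain xs where xs: "set xs = X"
    using finite_list by blast
  \<comment> \<open>Choosing the least index turns the overlapping net balls into disjoint cells,
    and keeps the choice measurable.\<close>
  define L where "L y = (LEAST i. y \<in> ball (xs ! i) \<delta>)" for y
  have L: "L y < length xs" "y \<in> ball (xs ! L y) \<delta>" if y: "y \<in> Q" for y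
  proof -
    obtain i where i: "i < length xs" "y \<in> ball (xs ! i) \<delta>"
    proof -
      from X(3) y xs obtain x where "x \<in> set xs" "y \<in> ball x \<delta>"
        by blast
      moreover from this(1) obtain i where "i < length xs" "xs ! i = x"
        unfolding in_set_conv_nth by blast
      ultimately show thesis
        by (intro that) auto
    qed
    show "y \<in> ball (xs ! L y) \<delta>"
      unfolding L_def using i(2) by (rule LeastI)
    have "L y \<le> i"
      unfolding L_def using i(2) by (rule Least_le)
    with i(1) show "L y < length xs" by simp
  qed
  \<comment> \<open>The shift by \<open>Suc\<close> reserves the index 0 for the complement of Q,
    the cell of infinite measure.\<close>
  define c where "c y = (if y \<in> Q then Suc (L y) else 0)" for y
  \<comment> \<open>The index shift is undone by \<open>k - 1\<close>. The guard on k makes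
    \<open>b k\<close> zero outside the list, where \<open>xs ! (k - 1)\<close> is not known to lie
    in Q; \<open>step_data\<close> wants square-integrability for all k.\<close>
  define b where "b k z = (if z \<in> Q' \<and> 0 < k \<and> k \<le> length xs then B (xs ! (k - 1), z) else 0)" for k z
  have b_sq: "square_integrable lborel (b k)" for k
  proof (cases "0 < k \<and> k \<le> length xs")
    case True
    then have xQ: "xs ! (k - 1) \<in> Q"
      using xs X(2) by (auto intro!: subsetD[OF X(2)])
    have "compact (B ` S n)"
      using compact_S cont by (intro compact_continuous_image) (auto intro: continuous_on_subset)
    then obtain M where M: "\<And>p. p \<in> S n \<Longrightarrow> cmod (B p) \<le> M"
      unfolding bounded_iff[symmetric] using compact_imp_bounded by (metis bounded_iff imageI)
    have "square_integrable lborel (\<lambda>z. complex_of_real M * indicator Q' z)"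
      using emeasure_bounded_finite[of Q']
      by (intro square_integrable_cmult square_integrable_indicator) (auto simp: Q'_def)
    then show ?thesis
    proof (rule square_integrable_bound(1))
      have "(\<lambda>z. B (xs ! (k - 1), z)) \<in> borel_measurable borel" by measurable
      then show "b k \<in> borel_measurable lborel"
        unfolding b_def by measurable
      show "cmod (b k z) \<le> cmod (complex_of_real M * indicator Q' z)" for z
        using M[of "(xs ! (k - 1), z)"] xQ by (auto simp: b_def SQ)
    qed
  next
    case False
    then have "b k = (\<lambda>z. 0)" by (auto simp: b_def)
    then show ?thesis by simp
  qed
  have c_meas: "c \<in> measurable borel (count_space UNIV)"
  proof -
    have "L \<in> measurable borel (count_space UNIV)"
      unfolding L_def[abs_def] mem_ball by measurable
    then show ?thesis unfolding c_def[abs_def] by measurable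
  qed
  have "range c \<subseteq> {..length xs}"
    using L(1) by (auto simp: c_def Suc_le_eq)
  then have c_fin: "finite (range c)"
    using finite_subset by blast
  have c_cell: "emeasure lborel (c -` {k}) < \<infinity>" if "k \<noteq> 0" for k
  proof -
    have "c -` {k} \<subseteq> Q" using that by (auto simp: c_def split: if_splits)
    then have "bounded (c -` {k})" unfolding Q_def using bounded_cball bounded_subset by blast
    then show ?thesis by (rule emeasure_bounded_finite)
  qed
  have cb: "step_data c b"
    using b_sq c_meas c_fin c_cell by (auto simp: step_data_def b_def)
  have D: "square_integrable lborel (step_kernel c b)"
    by (rule square_integrable_step_kernel[OF cb])
  then have [measurable]: "step_kernel c b \<in> borel_measurable borel"
    using square_integrable_measurable by fastforce
  have SB: "square_integrable lborel (\<lambda>p. indicator (S n) p * B p)"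
    by (rule square_integrable_bound(1)[OF B]) (auto simp: indicator_def)
  have near: "cmod (indicator (S n) p * B p - step_kernel c b p) \<le> cmod (complex_of_real \<epsilon>' * indicator (S n) p)" for p
  proof -
    obtain y z where p: "p = (y, z)" by (cases p)
    show ?thesis
    proof (cases "p \<in> S n")
      case True
      then have y: "y \<in> Q" and z: "z \<in> Q'" by (auto simp: p SQ)
      have x: "xs ! L y \<in> Q" using L(1)[OF y] X(2) xs nth_mem by blast
      have "dist y (xs ! L y) < \<delta>" using L(2)[OF y] by (simp add: dist_commute)
      then have "dist (B (y, z)) (B (xs ! L y, z)) < \<epsilon>'"
        using y z x by (intro \<delta>) (auto simp: SQ dist_Pair_Pair)
      then show ?thesis
        using True y z L(1)[OF y] \<open>0 < \<epsilon>'\<close>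
        by (simp add: p step_kernel_def c_def b_def dist_norm Suc_le_eq)
    next
      case False
      then show ?thesis by (auto simp: p SQ step_kernel_def c_def b_def)
    qed
  qed
  have SI: "square_integrable lborel (\<lambda>p. complex_of_real \<epsilon>' * indicator (S n) p)"
    by (intro square_integrable_cmult square_integrable_indicator) (use S_fin in auto)
  have "l2 lborel (\<lambda>p. indicator (S n) p * B p - step_kernel c b p) \<le> l2 lborel (\<lambda>p. complex_of_real \<epsilon>' * indicator (S n) p)"
    by (rule square_integrable_bound(2)[OF SI _ near]) simp
  also have "\<dots> = \<epsilon>' * sqrt (measure lborel (S n))"
    using S_fin \<open>0 < \<epsilon>'\<close> by (simp add: square_integrable_indicator(2))
  also have "\<dots> \<le> \<epsilon>' * (sqrt (measure lborel (S n)) + 1)"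
    using \<open>0 < \<epsilon>'\<close> by simp
  also have "\<dots> = \<epsilon> / 2"
  proof -
    have "\<epsilon> / (2 * m) * m = \<epsilon> / 2" if "0 < m" for m using that by simp
    from this[OF sq_pos] show ?thesis unfolding \<epsilon>'_def .
  qed
  finally have 2: "l2 lborel (\<lambda>p. indicator (S n) p * B p - step_kernel c b p) \<le> \<epsilon> / 2" .
  have "l2 lborel (\<lambda>p. (B p - indicator (S n) p * B p) + (indicator (S n) p * B p - step_kernel c b p))
      \<le> l2 lborel (\<lambda>p. B p - indicator (S n) p * B p) + l2 lborel (\<lambda>p. indicator (S n) p * B p - step_kernel c b p)"
    using B SB D by (intro square_integrable_add square_integrable_diff)
  with n 2 have "l2 lborel (\<lambda>p. B p - step_kernel c b p) \<le> \<epsilon>" by simp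
  with cb show ?thesis by blast
qed

text \<open>Two layers of exceptional sets occur. The inner identity fails on a null set of y, which
  the integral over y ignores; the outer one needs row x of A to be square-integrable.\<close>

lemma kernel_op_diff:
  fixes A :: "'a::euclidean_space \<times> 'b::euclidean_space \<Rightarrow> complex"
    and K :: "'b \<times> 'c::euclidean_space \<Rightarrow> complex"
  assumes A: "square_integrable lborel A" and K: "square_integrable lborel K"
    and K': "square_integrable lborel K'" and \<xi>: "square_integrable lborel \<xi>"
  shows "AE x in lborel. kernel_op A (kernel_op (\<lambda>p. K p - K' p) \<xi>) x =
    kernel_op A (kernel_op K \<xi>) x - kernel_op A (kernel_op K' \<xi>) x"
proof -
  have [measurable]: "A \<in> borel_measurable borel" "K \<in> borel_measurable borel"
    "K' \<in> borel_measurable borel" "\<xi> \<in> borel_measurable borel"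
    using A K K' \<xi> square_integrable_measurable by fastforce+
  note [measurable] = measurable_kernel_op
  have ae: "AE y in lborel. kernel_op (\<lambda>p. K p - K' p) \<xi> y = kernel_op K \<xi> y - kernel_op K' \<xi> y"
    using AE_square_integrable_section[OF K] AE_square_integrable_section[OF K']
  proof eventually_elim
    case (elim y)
    then show ?case
      using Cauchy_Schwarz_l2(1)[OF elim(1) \<xi>] Cauchy_Schwarz_l2(1)[OF elim(2) \<xi>]
      by (simp add: kernel_op_def left_diff_distrib)
  qed
  show ?thesis
    using AE_square_integrable_section[OF A]
  proof eventually_elim
    case (elim x)
    have "kernel_op A (kernel_op (\<lambda>p. K p - K' p) \<xi>) x
        = (LINT y|lborel. A (x, y) * (kernel_op K \<xi> y - kernel_op K' \<xi> y))"
      unfolding kernel_op_def[of A]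
      by (rule integral_cong_AE) (use ae in \<open>auto elim: eventually_mono\<close>)
    also have "\<dots> = kernel_op A (kernel_op K \<xi>) x - kernel_op A (kernel_op K' \<xi>) x"
      using Cauchy_Schwarz_l2(1)[OF elim kernel_op_Hilbert_Schmidt(1)[OF K \<xi>]]
        Cauchy_Schwarz_l2(1)[OF elim kernel_op_Hilbert_Schmidt(1)[OF K' \<xi>]]
      by (simp add: kernel_op_def[of A] right_diff_distrib)
    finally show ?case .
  qed
qed

section \<open>Nuclearity of products of Hilbert-Schmidt operators\<close>

text \<open>A pair (j, k) stands for cell k of the j-th telescoping block and is coded as one
  natural number. Cutting at J leaves two errors: A applied to the remainder B - S J, small by the
  Hilbert-Schmidt bound, and the terms enumerated so far that belong to later blocks, small by
  summability. J is fixed first, then N grows.\<close>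

lemma nuclear_decomposition:
  fixes A :: "'a::euclidean_space \<times> 'b::euclidean_space \<Rightarrow> complex"
    and B :: "'b \<times> 'c::euclidean_space \<Rightarrow> complex"
  assumes A: "square_integrable lborel A" and B: "square_integrable lborel B"
    and cont: "continuous_on UNIV B"
  shows "\<exists>u v. (\<forall>n. square_integrable lborel (u n)) \<and> (\<forall>n. square_integrable lborel (v n)) \<and>
    summable (\<lambda>n::nat. l2 lborel (u n) * l2 lborel (v n)) \<and>
    (\<forall>\<xi>. square_integrable lborel \<xi> \<longrightarrow>
      (\<lambda>N. l2 lborel (\<lambda>x. kernel_op A (kernel_op B \<xi>) x -
        (\<Sum>n<N. (LINT z|lborel. cnj (u n z) * \<xi> z) * v n x))) \<longlonglongrightarrow> 0)"
proof -
  have "\<forall>j. \<exists>cb. step_data (fst cb) (snd cb) \<and>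
      l2 lborel (\<lambda>p. B p - step_kernel (fst cb) (snd cb) p) \<le> (1/2) ^ j"
    using step_kernel_approximation[OF cont B] by simp
  then obtain F where F: "\<And>j. step_data (fst (F j)) (snd (F j))"
    "\<And>j. l2 lborel (\<lambda>p. B p - step_kernel (fst (F j)) (snd (F j)) p) \<le> (1/2) ^ j"
    by metis
  \<comment> \<open>Replacing the first approximant by the zero kernel lets the telescoping sum
    start from 0.\<close>
  define G :: "nat \<Rightarrow> ('b \<Rightarrow> nat) \<times> (nat \<Rightarrow> 'c \<Rightarrow> complex)"
    where "G j = (if j = 0 then ((\<lambda>y. 0), (\<lambda>k z. 0)) else F j)" for j
  define S where "S j = step_kernel (fst (G j)) (snd (G j))" for j
  define r where "r j = l2 lborel (\<lambda>p. B p - S j p)" for j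
  \<comment> \<open>The summand 1 covers j > 0, the norm of B covers j = 0, where the approximant is
    zero.\<close>
  define K where "K = 1 + l2 lborel B"
  have G: "step_data (fst (G j)) (snd (G j))" for j
    by (simp add: G_def F(1) step_data_zero)
  have S0: "S 0 = (\<lambda>p. 0)"
    by (simp add: S_def G_def step_kernel_def fun_eq_iff)
  have S: "square_integrable lborel (S j)" for j
    unfolding S_def by (rule square_integrable_step_kernel[OF G])
  have "1 \<le> K" by (simp add: K_def)
  have r_le: "r j \<le> K * (1/2) ^ j" for j
  proof (cases "j = 0")
    case True
    then show ?thesis by (simp add: r_def S0 K_def)
  next
    case False
    then have "r j \<le> (1/2) ^ j" using F(2)[of j] by (simp add: r_def S_def G_def)
    also have "\<dots> \<le> K * (1/2) ^ j" using \<open>1 \<le> K\<close> by simp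
    finally show ?thesis .
  qed
  have r_lim: "r \<longlonglongrightarrow> 0"
  proof (rule tendsto_sandwich[OF _ _ tendsto_const])
    show "(\<lambda>j. K * (1/2) ^ j) \<longlonglongrightarrow> 0"
      by (intro tendsto_mult_right_zero LIMSEQ_realpow_zero) auto
  qed (use r_le in \<open>auto simp: r_def\<close>)
  define c where "c j = (\<lambda>y. prod_encode (fst (G (Suc j)) y, fst (G j) y))" for j
  define b where "b j = (\<lambda>m z. snd (G (Suc j)) (fst (prod_decode m)) z - snd (G j) (snd (prod_decode m)) z)" for j
  have cb: "step_data (c j) (b j)" for j
    unfolding c_def b_def by (rule step_data_diff(1)[OF G G])
  have D: "step_kernel (c j) (b j) = (\<lambda>p. S (Suc j) p - S j p)" for j
    unfolding c_def b_def S_def by (rule ext) (rule step_data_diff(2)[OF G G])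
  define h where "h j = l2 lborel (step_kernel (c j) (b j))" for j
  have h_le: "h j \<le> 2 * K * (1/2) ^ j" for j
  proof -
    have "h j = l2 lborel (\<lambda>p. (B p - S j p) - (B p - S (Suc j) p))"
      by (simp add: h_def D)
    also have "\<dots> \<le> r j + r (Suc j)"
      unfolding r_def by (intro square_integrable_diff B S)
    also have "\<dots> \<le> 2 * K * (1/2) ^ j"
    proof -
      have "0 \<le> K * (1/2) ^ j" "K * (1/2) ^ Suc j = K * (1/2) ^ j / 2"
        using \<open>1 \<le> K\<close> by auto
      with r_le[of j] r_le[of "Suc j"] show ?thesis
        unfolding mult.assoc by linarith
    qed
    finally show ?thesis .
  qed
  have h_summable: "summable h"
  proof (rule summable_comparison_test')
    show "summable (\<lambda>j. 2 * K * (1/2) ^ j)"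
      by (intro summable_mult summable_geometric) simp
    show "norm (h j) \<le> 2 * K * (1/2) ^ j" for j
      using h_le[of j] by (simp add: h_def)
  qed
  define I where "I j = range (c j) - {0}" for j
  have I_fin: "finite (I j)" for j
    using cb[of j] by (auto simp: I_def step_data_def)
  \<comment> \<open>Padding with zero makes all pairs of naturals admissible indices: codes that
    belong to no cell contribute nothing.\<close>
  define V where "V p = (if snd p \<in> I (fst p) then kernel_op A (indicator (c (fst p) -` {snd p})) else (\<lambda>x. 0))"
    for p :: "nat \<times> nat"
  \<comment> \<open>The conjugate cancels the one in the inner product, so that the coefficient
    becomes the bilinear pairing of \<xi> with the value of the step kernel.\<close>
  define U where "U p = (\<lambda>z. cnj (b (fst p) (snd p) z))" for p :: "nat \<times> nat"
  define t where "t p = l2 lborel (U p) * l2 lborel (V p)" for p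
  define u where "u n = U (prod_decode n)" for n
  define v where "v n = V (prod_decode n)" for n
  have t_nonneg: "0 \<le> t p" for p by (simp add: t_def)
  have U_sq: "square_integrable lborel (U p)" for p
    using cb[of "fst p"] unfolding U_def step_data_def by (intro square_integrable_cnj) auto
  have V_sq: "square_integrable lborel (V p)" for p
    unfolding V_def by (auto simp: I_def intro!: nuclear_norm_step_kernel(2)[OF A cb])
  have block: "(\<Sum>k\<in>I j. t (j, k)) \<le> l2 lborel A * h j" for j
    using nuclear_norm_step_kernel(1)[OF A cb, of j]
    by (simp add: t_def U_def V_def h_def I_def)
  define W where "W J = (SIGMA j:{..<J}. I j)" for J
  have W_fin: "finite (W J)" for J
    unfolding W_def by (intro finite_SigmaI I_fin) simp
  \<comment> \<open>A code is at least its block number. Hence the first N codes meet only blocks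
    below N, which bounds the partial sums of nuclear norms, and a code below J belongs to a block
    below J, which controls the tail.\<close>
  have fst_le: "fst (prod_decode n) \<le> n" for n
    using le_prod_encode_1[of "fst (prod_decode n)" "snd (prod_decode n)"] by simp
  have outside: "V p = (\<lambda>x. 0)" if "fst p < J" "p \<notin> W J" for p J
    using that by (cases p) (auto simp: V_def W_def)
  have summable: "summable (\<lambda>n. l2 lborel (u n) * l2 lborel (v n))"
  proof (rule summableI_nonneg_bounded)
    fix N
    have "(\<Sum>n<N. l2 lborel (u n) * l2 lborel (v n)) = (\<Sum>n<N. t (prod_decode n))"
      by (simp add: t_def u_def v_def)
    also have "\<dots> = (\<Sum>p\<in>prod_decode ` {..<N}. t p)"
      by (simp add: sum.reindex inj_prod_decode)
    also have "\<dots> = (\<Sum>p\<in>prod_decode ` {..<N} \<inter> W N. t p)"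
    proof (rule sum.mono_neutral_right)
      show "\<forall>p\<in>prod_decode ` {..<N} - prod_decode ` {..<N} \<inter> W N. t p = 0"
      proof
        fix p assume "p \<in> prod_decode ` {..<N} - prod_decode ` {..<N} \<inter> W N"
        then obtain n where "n < N" "p = prod_decode n" "p \<notin> W N" by auto
        with fst_le[of n] outside[of p N] show "t p = 0" by (simp add: t_def)
      qed
    qed auto
    also have "\<dots> \<le> (\<Sum>p\<in>W N. t p)"
      by (intro sum_mono2 W_fin) (auto simp: t_nonneg)
    also have "\<dots> = (\<Sum>j<N. \<Sum>k\<in>I j. t (j, k))"
      unfolding W_def using I_fin by (simp add: sum.Sigma)
    also have "\<dots> \<le> (\<Sum>j<N. l2 lborel A * h j)"
      by (intro sum_mono block)
    also have "\<dots> = l2 lborel A * (\<Sum>j<N. h j)"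
      by (simp add: sum_distrib_left)
    also have "\<dots> \<le> l2 lborel A * suminf h"
      by (intro mult_left_mono sum_le_suminf h_summable) (auto simp: h_def)
    finally show "(\<Sum>n<N. l2 lborel (u n) * l2 lborel (v n)) \<le> l2 lborel A * suminf h" .
  qed simp
  define \<tau> where "\<tau> n = l2 lborel (u n) * l2 lborel (v n)" for n
  have \<tau>: "summable \<tau>" "0 \<le> \<tau> n" for n
    using summable by (auto simp: \<tau>_def[abs_def])
  have "(\<lambda>N. l2 lborel (\<lambda>x. kernel_op A (kernel_op B \<xi>) x -
        (\<Sum>n<N. (LINT z|lborel. cnj (u n z) * \<xi> z) * v n x))) \<longlonglongrightarrow> 0"
    if \<xi>: "square_integrable lborel \<xi>" for \<xi>
  proof -
    define T where "T = kernel_op A (kernel_op B \<xi>)"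
    define rk where "rk n = (\<lambda>x. (LINT z|lborel. cnj (u n z) * \<xi> z) * v n x)" for n
    have T_sq: "square_integrable lborel T"
      unfolding T_def by (intro kernel_op_Hilbert_Schmidt A B \<xi>)
    have rk_sq: "square_integrable lborel (rk n)" for n
      unfolding rk_def v_def by (intro square_integrable_cmult V_sq)
    have rk_le: "l2 lborel (rk n) \<le> l2 lborel \<xi> * \<tau> n" for n
    proof -
      have "cmod (LINT z|lborel. cnj (u n z) * \<xi> z) \<le> l2 lborel (u n) * l2 lborel \<xi>"
        using Cauchy_Schwarz_l2(3)[OF square_integrable_cnj[OF U_sq[of "prod_decode n"]] \<xi>]
        by (simp add: u_def)
      then have "l2 lborel (rk n) \<le> (l2 lborel (u n) * l2 lborel \<xi>) * l2 lborel (v n)"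
        unfolding rk_def l2_cmult by (rule mult_right_mono) simp
      then show ?thesis by (simp add: \<tau>_def mult_ac)
    qed
    \<comment> \<open>Over complete blocks the rank-one terms telescope to the operator with
      \<open>S J\<close> in place of B; the exceptional sets of the countably many blocks unite to
      one null set.\<close>
    have partial: "AE x in lborel. (\<Sum>n\<in>prod_encode ` W J. rk n x) = kernel_op A (kernel_op (S J) \<xi>) x" for J
    proof -
      have "AE x in lborel. kernel_op A (kernel_op (S (Suc j)) \<xi>) x - kernel_op A (kernel_op (S j) \<xi>) x
          = (\<Sum>k\<in>I j. rk (prod_encode (j, k)) x)" for j
        using kernel_op_diff[OF A S S \<xi>, of "Suc j" j] kernel_op_step_kernel[OF A cb \<xi>, of j]
      proof eventually_elim
        case (elim x)
        have "kernel_op A (kernel_op (S (Suc j)) \<xi>) x - kernel_op A (kernel_op (S j) \<xi>) x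
            = kernel_op A (kernel_op (step_kernel (c j) (b j)) \<xi>) x"
          using elim(1) by (simp add: D)
        also have "\<dots> = (\<Sum>k\<in>I j. rk (prod_encode (j, k)) x)"
          unfolding elim(2) by (intro sum.cong) (auto simp: I_def rk_def u_def v_def U_def V_def)
        finally show ?case .
      qed
      then have "AE x in lborel. \<forall>j. kernel_op A (kernel_op (S (Suc j)) \<xi>) x - kernel_op A (kernel_op (S j) \<xi>) x
          = (\<Sum>k\<in>I j. rk (prod_encode (j, k)) x)"
        by (simp add: AE_all_countable)
      then show ?thesis
      proof eventually_elim
        case (elim x)
        have "(\<Sum>n\<in>prod_encode ` W J. rk n x) = (\<Sum>p\<in>W J. rk (prod_encode p) x)"
          by (simp add: sum.reindex inj_prod_encode)
        also have "\<dots> = (\<Sum>j<J. \<Sum>k\<in>I j. rk (prod_encode (j, k)) x)"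
          unfolding W_def using I_fin by (simp add: sum.Sigma)
        also have "\<dots> = (\<Sum>j<J. kernel_op A (kernel_op (S (Suc j)) \<xi>) x - kernel_op A (kernel_op (S j) \<xi>) x)"
          using elim by simp
        also have "\<dots> = kernel_op A (kernel_op (S J) \<xi>) x - kernel_op A (kernel_op (S 0) \<xi>) x"
          by (rule sum_lessThan_telescope)
        finally show ?case by (simp add: S0 kernel_op_def)
      qed
    qed
    \<comment> \<open>N need not be aligned with the blocks. Once all codes of the blocks below J
      are among the first N, the error splits into the remainder of B after \<open>S J\<close> and
      the surplus codes \<open>?Q\<close>. Taking N at least J makes the estimate of the surplus a
      difference of partial sums.\<close>
    have bound: "\<forall>\<^sub>F N in sequentially. l2 lborel (\<lambda>x. T x - (\<Sum>n<N. rk n x))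
        \<le> l2 lborel A * (r J * l2 lborel \<xi>) + l2 lborel \<xi> * (suminf \<tau> - sum \<tau> {..<J})" for J
    proof -
      let ?P = "prod_encode ` W J"
      have "finite ?P" using W_fin by simp
      then obtain N0 where N0: "?P \<subseteq> {..<N0}"
        using finite_nat_iff_bounded by blast
      have "l2 lborel (\<lambda>x. T x - (\<Sum>n<N. rk n x))
        \<le> l2 lborel A * (r J * l2 lborel \<xi>) + l2 lborel \<xi> * (suminf \<tau> - sum \<tau> {..<J})"
        if N: "N \<ge> max N0 J" for N
      proof -
        define R where "R = kernel_op A (kernel_op (\<lambda>p. B p - S J p) \<xi>)"
        let ?Q = "{..<N} - ?P"
        have sub: "?P \<subseteq> {..<N}" using N0 N by auto
        have diff_sq: "square_integrable lborel (\<lambda>p. B p - S J p)"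
          by (intro square_integrable_diff B S)
        have R_sq: "square_integrable lborel R"
          unfolding R_def by (intro kernel_op_Hilbert_Schmidt A diff_sq \<xi>)
        have "AE x in lborel. T x - (\<Sum>n<N. rk n x) = R x - (\<Sum>n\<in>?Q. rk n x)"
          using partial[of J] kernel_op_diff[OF A B S \<xi>, of J]
        proof eventually_elim
          case (elim x)
          have "(\<Sum>n<N. rk n x) = (\<Sum>n\<in>?Q. rk n x) + (\<Sum>n\<in>?P. rk n x)"
            using sub by (intro sum.subset_diff) auto
          with elim show ?case by (simp add: T_def R_def)
        qed
        then have "l2 lborel (\<lambda>x. T x - (\<Sum>n<N. rk n x)) = l2 lborel (\<lambda>x. R x - (\<Sum>n\<in>?Q. rk n x))"
          using T_sq R_sq rk_sq
          by (intro l2_cong_AE square_integrable_measurable square_integrable_diff square_integrable_sum) auto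
        also have "\<dots> \<le> l2 lborel R + l2 lborel (\<lambda>x. \<Sum>n\<in>?Q. rk n x)"
          by (intro square_integrable_diff square_integrable_sum R_sq rk_sq) auto
        also have "l2 lborel R \<le> l2 lborel A * (r J * l2 lborel \<xi>)"
        proof -
          have "l2 lborel R \<le> l2 lborel A * l2 lborel (kernel_op (\<lambda>p. B p - S J p) \<xi>)"
            unfolding R_def by (intro kernel_op_Hilbert_Schmidt A diff_sq \<xi>)
          also have "\<dots> \<le> l2 lborel A * (r J * l2 lborel \<xi>)"
            unfolding r_def by (intro mult_left_mono kernel_op_Hilbert_Schmidt diff_sq \<xi>) auto
          finally show ?thesis .
        qed
        also have "l2 lborel (\<lambda>x. \<Sum>n\<in>?Q. rk n x) \<le> (\<Sum>n\<in>?Q. l2 lborel (rk n))"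
          by (intro square_integrable_sum rk_sq) auto
        also have "\<dots> \<le> (\<Sum>n\<in>?Q. l2 lborel \<xi> * \<tau> n)"
          by (intro sum_mono rk_le)
        \<comment> \<open>A surplus code below J lies in a block below J without naming one of its
          cells, so it is padding. The surplus thus starts at J and is dominated by the tail of
          \<tau>.\<close>
        also have "\<dots> = (\<Sum>n\<in>?Q - {..<J}. l2 lborel \<xi> * \<tau> n)"
        proof (rule sum.mono_neutral_right)
          show "\<forall>n\<in>?Q - (?Q - {..<J}). l2 lborel \<xi> * \<tau> n = 0"
          proof
            fix n assume n: "n \<in> ?Q - (?Q - {..<J})"
            then have "prod_decode n \<notin> W J"
              by (metis DiffD1 DiffD2 imageI prod_decode_inverse)
            moreover have "fst (prod_decode n) < J"
              using n fst_le[of n] by auto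
            ultimately show "l2 lborel \<xi> * \<tau> n = 0"
              using outside by (simp add: \<tau>_def v_def)
          qed
        qed auto
        also have "\<dots> \<le> (\<Sum>n\<in>{..<N} - {..<J}. l2 lborel \<xi> * \<tau> n)"
          by (intro sum_mono2) (auto simp: \<tau>)
        also have "\<dots> = l2 lborel \<xi> * (sum \<tau> {..<N} - sum \<tau> {..<J})"
          using N by (subst sum_diff) (auto simp: sum_distrib_left right_diff_distrib)
        also have "\<dots> \<le> l2 lborel \<xi> * (suminf \<tau> - sum \<tau> {..<J})"
          using sum_le_suminf[OF \<tau>(1), of "{..<N}"] \<tau>(2) by (intro mult_left_mono) auto
        finally show ?thesis by simp
      qed
      then show ?thesis
        unfolding eventually_sequentially by blast
    qed
    have lim: "(\<lambda>J. l2 lborel A * (r J * l2 lborel \<xi>) + l2 lborel \<xi> * (suminf \<tau> - sum \<tau> {..<J})) \<longlonglongrightarrow>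
        l2 lborel A * (0 * l2 lborel \<xi>) + l2 lborel \<xi> * (suminf \<tau> - suminf \<tau>)"
      by (intro tendsto_intros r_lim summable_LIMSEQ \<tau>)
    have "(\<lambda>N. l2 lborel (\<lambda>x. T x - (\<Sum>n<N. rk n x))) \<longlonglongrightarrow> 0"
    proof (rule order_tendstoI)
      fix e :: real assume "e < 0"
      then show "\<forall>\<^sub>F N in sequentially. e < l2 lborel (\<lambda>x. T x - (\<Sum>n<N. rk n x))"
        by (intro always_eventually allI less_le_trans[OF _ l2_nonneg])
    next
      fix e :: real assume "0 < e"
      with lim have "\<forall>\<^sub>F J in sequentially.
          l2 lborel A * (r J * l2 lborel \<xi>) + l2 lborel \<xi> * (suminf \<tau> - sum \<tau> {..<J}) < e"
        by (intro order_tendstoD(2)) auto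
      then obtain J where J: "l2 lborel A * (r J * l2 lborel \<xi>) + l2 lborel \<xi> * (suminf \<tau> - sum \<tau> {..<J}) < e"
        unfolding eventually_sequentially by blast
      show "\<forall>\<^sub>F N in sequentially. l2 lborel (\<lambda>x. T x - (\<Sum>n<N. rk n x)) < e"
        using bound[of J] by eventually_elim (use J in linarith)
    qed
    then show ?thesis by (simp add: T_def rk_def)
  qed
  moreover have "square_integrable lborel (u n)" "square_integrable lborel (v n)" for n
    unfolding u_def v_def by (rule U_sq V_sq)+
  ultimately show ?thesis
    using summable by (intro exI[of _ u] exI[of _ v]) simp
qed

section \<open>Reduction to scalar functions\<close>

lemma square_integrable_if: "square_integrable M u \<Longrightarrow> square_integrable M (\<lambda>x. if P then u x else 0)"
  by (cases P) auto

lemma inL2_eq: "inL2 = square_integrable hmeas"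
  by (simp add: inL2_def[abs_def] square_integrable_def[abs_def])

lemma l2norm_eq: "l2norm = l2 hmeas"
  by (simp add: l2norm_def[abs_def] l2_def[abs_def])

lemma borel_measurable_hmeas_iff:
  "u \<in> borel_measurable hmeas \<longleftrightarrow> (\<forall>i. (\<lambda>x. u (x, i)) \<in> borel_measurable lborel)"
proof
  assume u: "u \<in> borel_measurable hmeas"
  have "(\<lambda>x. (x, i)) \<in> measurable lborel hmeas" for i :: bool
    unfolding hmeas_def by measurable
  from measurable_compose[OF this u] show "\<forall>i. (\<lambda>x. u (x, i)) \<in> borel_measurable lborel"
    by simp
next
  assume "\<forall>i. (\<lambda>x. u (x, i)) \<in> borel_measurable lborel"
  then have [measurable]: "(\<lambda>x. u (x, i)) \<in> borel_measurable borel" for i by simp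
  have "u = (\<lambda>p. if snd p then u (fst p, True) else u (fst p, False))"
    by (auto simp: fun_eq_iff)
  moreover have "(\<lambda>p. if snd p then u (fst p, True) else u (fst p, False)) \<in> borel_measurable hmeas"
    unfolding hmeas_def by measurable
  ultimately show "u \<in> borel_measurable hmeas" by simp
qed

lemma nn_integral_hmeas:
  assumes "f \<in> borel_measurable hmeas"
  shows "(\<integral>\<^sup>+p. f p \<partial>hmeas) = (\<integral>\<^sup>+x. f (x, False) \<partial>lborel) + (\<integral>\<^sup>+x. f (x, True) \<partial>lborel)"
proof -
  interpret C: sigma_finite_measure "count_space (UNIV :: bool set)"
    by (rule sigma_finite_measure_count_space_finite) simp
  have f: "f \<in> borel_measurable (lborel \<Otimes>\<^sub>M count_space (UNIV :: bool set))"
    using assms by (simp add: hmeas_def)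
  have [measurable]: "(\<lambda>x. f (x, i)) \<in> borel_measurable borel" for i
    using measurable_compose[OF measurable_Pair2', of i, OF _ f] by simp
  have "(\<integral>\<^sup>+p. f p \<partial>hmeas) = (\<integral>\<^sup>+x. \<integral>\<^sup>+i. f (x, i) \<partial>count_space UNIV \<partial>lborel)"
    using C.nn_integral_fst[OF f] by (simp add: hmeas_def)
  also have "\<dots> = (\<integral>\<^sup>+x. f (x, False) + f (x, True) \<partial>lborel)"
    by (simp add: nn_integral_count_space_finite UNIV_bool)
  also have "\<dots> = (\<integral>\<^sup>+x. f (x, False) \<partial>lborel) + (\<integral>\<^sup>+x. f (x, True) \<partial>lborel)"
    by (rule nn_integral_add) auto
  finally show ?thesis .
qed

lemma square_integrable_hmeas_iff:
  "square_integrable hmeas u \<longleftrightarrow> (\<forall>i. square_integrable lborel (\<lambda>x. u (x, i)))"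
proof -
  have iff: "square_integrable M w \<longleftrightarrow> w \<in> borel_measurable M \<and> (\<integral>\<^sup>+x. ennreal ((cmod (w x))\<^sup>2) \<partial>M) < \<infinity>"
    for M :: "'a measure" and w
  proof
    assume "square_integrable M w"
    from square_integrable_measurable[OF this] nn_integral_square[OF this]
    show "w \<in> borel_measurable M \<and> (\<integral>\<^sup>+x. ennreal ((cmod (w x))\<^sup>2) \<partial>M) < \<infinity>"
      by simp
  qed (auto intro: square_integrableI)
  have "(\<lambda>p. ennreal ((cmod (u p))\<^sup>2)) \<in> borel_measurable hmeas" if "u \<in> borel_measurable hmeas"
    using that by measurable
  from nn_integral_hmeas[OF this] show ?thesis
    unfolding iff borel_measurable_hmeas_iff by (auto simp: all_bool_eq)
qed

text \<open>Both parts come from the Pythagorean identity for the two components. The inequality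
  serves for the error of a partial sum, the equality for vectors supported in one
  component.\<close>

lemma l2_hmeas_le:
  assumes "square_integrable hmeas u"
  shows "l2 hmeas u \<le> l2 lborel (\<lambda>x. u (x, False)) + l2 lborel (\<lambda>x. u (x, True))"
    and "(\<And>x. u (x, \<not> i) = 0) \<Longrightarrow> l2 hmeas u = l2 lborel (\<lambda>x. u (x, i))"
proof -
  have [measurable]: "u \<in> borel_measurable hmeas"
    using assms by (rule square_integrable_measurable)
  have sq: "square_integrable lborel (\<lambda>x. u (x, i))" for i
    using assms by (simp add: square_integrable_hmeas_iff)
  have "(\<integral>\<^sup>+p. ennreal ((cmod (u p))\<^sup>2) \<partial>hmeas)
      = ennreal ((l2 lborel (\<lambda>x. u (x, False)))\<^sup>2 + (l2 lborel (\<lambda>x. u (x, True)))\<^sup>2)"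
    by (subst nn_integral_hmeas) (simp_all add: nn_integral_square[OF sq])
  then have eq: "(l2 hmeas u)\<^sup>2 = (l2 lborel (\<lambda>x. u (x, False)))\<^sup>2 + (l2 lborel (\<lambda>x. u (x, True)))\<^sup>2"
    by (simp add: nn_integral_square[OF assms] del: ennreal_plus)
  also have "\<dots> \<le> (l2 lborel (\<lambda>x. u (x, False)) + l2 lborel (\<lambda>x. u (x, True)))\<^sup>2"
    by (simp add: power2_sum)
  finally show "l2 hmeas u \<le> l2 lborel (\<lambda>x. u (x, False)) + l2 lborel (\<lambda>x. u (x, True))"
    by (rule power2_le_imp_le) simp
  assume "\<And>x. u (x, \<not> i) = 0"
  then have "(l2 hmeas u)\<^sup>2 = (l2 lborel (\<lambda>x. u (x, i)))\<^sup>2"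
    using eq by (cases i) simp_all
  then show "l2 hmeas u = l2 lborel (\<lambda>x. u (x, i))"
    by (simp add: power2_eq_iff_nonneg)
qed

lemma l2inner_component:
  assumes u: "square_integrable lborel u" and \<xi>: "inL2 \<xi>"
  shows "l2inner (\<lambda>(x, j). if j = i then u x else 0) \<xi> = (LINT x|lborel. cnj (u x) * \<xi> (x, i))"
proof -
  interpret C: sigma_finite_measure "count_space (UNIV :: bool set)"
    by (rule sigma_finite_measure_count_space_finite) simp
  interpret P: pair_sigma_finite "lborel :: (real \<times> real) measure" "count_space (UNIV :: bool set)" ..
  let ?u = "\<lambda>(x, j). if j = i then u x else 0"
  have "square_integrable hmeas ?u"
    using u by (simp add: square_integrable_hmeas_iff square_integrable_if)
  from Cauchy_Schwarz_l2(1)[OF square_integrable_cnj[OF this] \<xi>[unfolded inL2_eq]]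
  have int: "integrable (lborel \<Otimes>\<^sub>M count_space UNIV) (\<lambda>p. cnj (?u p) * \<xi> p)"
    by (simp add: hmeas_def)
  have "l2inner ?u \<xi> = (LINT x|lborel. LINT j|count_space UNIV. cnj (?u (x, j)) * \<xi> (x, j))"
    unfolding l2inner_def hmeas_def by (rule P.integral_fst'[OF int, symmetric])
  also have "\<dots> = (LINT x|lborel. cnj (u x) * \<xi> (x, i))"
    by (cases i) (simp_all add: lebesgue_integral_count_space_finite UNIV_bool)
  finally show ?thesis .
qed

text \<open>T is T0 tensored with the identity of C^2. Each rank-one term is used once per
  component, interleaved: even indices act on the component \<open>False\<close>, odd ones on
  \<open>True\<close>. The nuclear sum doubles.\<close>

lemma trace_class_componentwise:
  assumes T: "\<And>\<xi> x i. inL2 \<xi> \<Longrightarrow> T \<xi> (x, i) = T0 (\<lambda>y. \<xi> (y, i)) x"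
    and T0: "\<And>\<xi>. square_integrable lborel \<xi> \<Longrightarrow> square_integrable lborel (T0 \<xi>)"
    and u: "\<And>n. square_integrable lborel (u n)" and v: "\<And>n. square_integrable lborel (v n)"
    and summable: "summable (\<lambda>n::nat. l2 lborel (u n) * l2 lborel (v n))"
    and lim: "\<And>\<xi>. square_integrable lborel \<xi> \<Longrightarrow>
      (\<lambda>N. l2 lborel (\<lambda>x. T0 \<xi> x - (\<Sum>n<N. (LINT z|lborel. cnj (u n z) * \<xi> z) * v n x))) \<longlonglongrightarrow> 0"
  shows "trace_class T"
proof -
  define U where "U n = (\<lambda>(x, j). if j = odd n then u (n div 2) x else 0)" for n
  define V where "V n = (\<lambda>(x, j). if j = odd n then v (n div 2) x else 0)" for n
  have U: "inL2 (U n)" and V: "inL2 (V n)" for n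
    using u v by (simp_all add: inL2_eq square_integrable_hmeas_iff square_integrable_if U_def V_def)
  have norms: "l2norm (U n) = l2 lborel (u (n div 2))" "l2norm (V n) = l2 lborel (v (n div 2))" for n
    using l2_hmeas_le(2)[OF U[unfolded inL2_eq], where i="odd n"] l2_hmeas_le(2)[OF V[unfolded inL2_eq], where i="odd n"]
    by (simp_all add: l2norm_eq U_def V_def)
  have TL2: "inL2 (T \<xi>)" if "inL2 \<xi>" for \<xi>
    using that T0 by (simp add: T[OF that] inL2_eq square_integrable_hmeas_iff)
  define t where "t n = l2 lborel (u n) * l2 lborel (v n)" for n
  have "summable (\<lambda>n. t (n div 2))"
  proof (rule summableI_nonneg_bounded)
    fix N :: nat
    have double: "(\<Sum>n<2 * N. t (n div 2)) = 2 * (\<Sum>n<N. t n)" for N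
      by (induction N) auto
    have "(\<Sum>n<N. t (n div 2)) \<le> (\<Sum>n<2 * N. t (n div 2))"
      by (intro sum_mono2) (auto simp: t_def)
    also have "\<dots> \<le> 2 * suminf t"
      unfolding double using summable
      by (intro mult_left_mono sum_le_suminf) (auto simp: t_def[abs_def])
    finally show "(\<Sum>n<N. t (n div 2)) \<le> 2 * suminf t" .
  qed (simp add: t_def)
  then have sum: "summable (\<lambda>n. l2norm (U n) * l2norm (V n))"
    by (simp add: norms t_def)
  have conv: "(\<lambda>N. l2norm (\<lambda>x. T \<xi> x - (\<Sum>n<N. l2inner (U n) \<xi> * V n x))) \<longlonglongrightarrow> 0"
    if \<xi>: "inL2 \<xi>" for \<xi>
  proof -
    define \<xi>' where "\<xi>' i = (\<lambda>x. \<xi> (x, i))" for i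
    have \<xi>': "square_integrable lborel (\<xi>' i)" for i
      using \<xi> by (simp add: inL2_eq square_integrable_hmeas_iff \<xi>'_def)
    \<comment> \<open>The number of n < N with \<open>odd n = i\<close>, that is, how many terms the
      partial sum has spent on component i.\<close>
    define m where "m i N = (if i then N div 2 else Suc N div 2)" for i and N :: nat
    define e where "e i N = l2 lborel (\<lambda>x. T0 (\<xi>' i) x - (\<Sum>n<N. (LINT z|lborel. cnj (u n z) * \<xi>' i z) * v n x))"
      for i N
    have inner: "l2inner (U n) \<xi> = (LINT z|lborel. cnj (u (n div 2) z) * \<xi>' (odd n) z)" for n
      unfolding U_def \<xi>'_def by (rule l2inner_component[OF u \<xi>])
    have partial: "(\<Sum>n<N. l2inner (U n) \<xi> * V n (x, i)) = (\<Sum>n<m i N. (LINT z|lborel. cnj (u n z) * \<xi>' i z) * v n x)"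
      for N x i
    proof (induction N)
      case (Suc N)
      show ?case
        by (cases "odd N"; cases i) (use Suc.IH in \<open>auto simp: m_def inner V_def elim!: oddE evenE\<close>)
    qed (simp add: m_def)
    have le: "l2norm (\<lambda>x. T \<xi> x - (\<Sum>n<N. l2inner (U n) \<xi> * V n x)) \<le> e False (m False N) + e True (m True N)" for N
    proof -
      have "inL2 (\<lambda>x. T \<xi> x - (\<Sum>n<N. l2inner (U n) \<xi> * V n x))"
        using TL2[OF \<xi>] V unfolding inL2_eq
        by (intro square_integrable_diff square_integrable_sum square_integrable_cmult) auto
      from l2_hmeas_le(1)[OF this[unfolded inL2_eq]] show ?thesis
        by (simp add: l2norm_eq e_def T[OF \<xi>] partial \<xi>'_def)
    qed
    have e: "(\<lambda>N. e i (m i N)) \<longlonglongrightarrow> 0" for i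
    proof -
      have "filterlim (m i) at_top sequentially"
        unfolding filterlim_at_top
      proof
        fix Z
        show "\<forall>\<^sub>F N in sequentially. Z \<le> m i N"
          unfolding eventually_sequentially by (intro exI[of _ "2 * Z"]) (auto simp: m_def)
      qed
      from filterlim_compose[OF lim[OF \<xi>'] this] show ?thesis
        by (simp add: e_def)
    qed
    have lim: "(\<lambda>N. e False (m False N) + e True (m True N)) \<longlonglongrightarrow> 0"
      using tendsto_add[OF e e] by simp
    show ?thesis
      by (rule tendsto_sandwich[OF _ _ tendsto_const lim]) (use le in \<open>auto simp: l2norm_eq\<close>)
  qed
  show ?thesis
    unfolding trace_class_def using TL2 U V sum conv by (intro conjI exI[of _ U] exI[of _ V]) auto
qed

section \<open>Integrability of the weight\<close>

text \<open>Comparable to the power -q of the Japanese bracket, the square root of 1 + u^2. It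
  measures both the resolvent, with q = s / 2, and the functions of \<open>A_S\<close>, with q =
  2.\<close>

definition japanese_decay :: "real \<Rightarrow> real \<Rightarrow> real" where
  "japanese_decay q u = (1 + \<bar>u\<bar>) powr (- q)"

lemma japanese_decay_nonneg [simp]: "0 \<le> japanese_decay q u"
  by (simp add: japanese_decay_def)

lemma japanese_decay_minus [simp]: "japanese_decay q (- u) = japanese_decay q u"
  by (simp add: japanese_decay_def)

lemma measurable_japanese_decay [measurable]: "japanese_decay q \<in> borel_measurable borel"
  unfolding japanese_decay_def[abs_def] by measurable

text \<open>Only an upper bound is claimed: the split counts the point 0 twice, which avoids an
  argument about null sets.\<close>

lemma nn_integral_even:
  fixes f :: "real \<Rightarrow> ennreal"
  assumes [measurable]: "f \<in> borel_measurable borel" and even: "\<And>x. f (- x) = f x"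
  shows "(\<integral>\<^sup>+x. f x \<partial>lborel) \<le> 2 * (\<integral>\<^sup>+x. f x * indicator {0..} x \<partial>lborel)"
proof -
  have "(\<integral>\<^sup>+x. f x \<partial>lborel) \<le> (\<integral>\<^sup>+x. f x * indicator {0..} x + f x * indicator {0..} (- x) \<partial>lborel)"
    by (intro nn_integral_mono) (auto simp: indicator_def)
  also have "\<dots> = (\<integral>\<^sup>+x. f x * indicator {0..} x \<partial>lborel) + (\<integral>\<^sup>+x. f x * indicator {0..} (- x) \<partial>lborel)"
    by (rule nn_integral_add) auto
  also have "(\<integral>\<^sup>+x. f x * indicator {0..} (- x) \<partial>lborel) = (\<integral>\<^sup>+x. f x * indicator {0..} x \<partial>lborel)"
    by (subst nn_integral_real_affine[where c="-1" and t=0]) (auto simp: even)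
  finally show ?thesis by (simp add: mult_2)
qed

lemma nn_integral_japanese_decay:
  assumes "1 < q"
  shows "(\<integral>\<^sup>+u. ennreal (japanese_decay q u) \<partial>lborel) < \<infinity>"
proof -
  have "(\<integral>\<^sup>+u. ennreal (japanese_decay q u) \<partial>lborel)
      \<le> 2 * (\<integral>\<^sup>+u. ennreal (japanese_decay q u) * indicator {0..} u \<partial>lborel)"
    by (intro nn_integral_even) auto
  also have "(\<integral>\<^sup>+u. ennreal (japanese_decay q u) * indicator {0..} u \<partial>lborel)
      = (\<integral>\<^sup>+u. ennreal ((1 + u) powr (- q)) * indicator {0..} u \<partial>lborel)"
    by (intro nn_integral_cong) (auto simp: japanese_decay_def indicator_def)
  also have "\<dots> = ennreal (0 - (- ((1 + 0) powr (1 - q)) / (q - 1)))"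
  proof (rule nn_integral_FTC_atLeast)
    show "((\<lambda>u. - ((1 + u) powr (1 - q)) / (q - 1)) has_real_derivative (1 + u) powr (- q)) (at u)"
      if "0 \<le> u" for u
    proof -
      have "((\<lambda>u. - ((1 + u) powr (1 - q)) / (q - 1)) has_real_derivative
          - ((1 - q) * (1 + u) powr (1 - q - 1)) / (q - 1)) (at u)"
        using that assms by (auto intro!: derivative_eq_intros)
      moreover have "- ((1 - q) * w) / (q - 1) = w" for w
        using assms by (simp add: field_simps)
      ultimately show ?thesis by simp
    qed
    have "((\<lambda>u. (1 + u) powr (1 - q)) \<longlongrightarrow> 0) at_top"
      using assms
      by (intro tendsto_neg_powr filterlim_tendsto_add_at_top[OF tendsto_const] filterlim_ident) auto
    from tendsto_divide[OF tendsto_minus[OF this] tendsto_const[of "q - 1"]]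
    show "((\<lambda>u. - ((1 + u) powr (1 - q)) / (q - 1)) \<longlongrightarrow> 0) at_top"
      using assms by simp
  qed auto
  finally show ?thesis
    by (rule le_less_trans) (simp add: ennreal_mult_less_top)
qed

lemma nn_integral_exp_decay:
  assumes "0 < (k :: real)"
  shows "(\<integral>\<^sup>+u. ennreal (exp (- k * \<bar>u\<bar>)) \<partial>lborel) < \<infinity>"
proof -
  have "(\<integral>\<^sup>+u. ennreal (exp (- k * \<bar>u\<bar>)) \<partial>lborel)
      \<le> 2 * (\<integral>\<^sup>+u. ennreal (exp (- k * \<bar>u\<bar>)) * indicator {0..} u \<partial>lborel)"
    by (intro nn_integral_even) auto
  also have "(\<integral>\<^sup>+u. ennreal (exp (- k * \<bar>u\<bar>)) * indicator {0..} u \<partial>lborel)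
      = (\<integral>\<^sup>+u. ennreal (exp (- k * u)) * indicator {0..} u \<partial>lborel)"
    by (intro nn_integral_cong) (auto simp: indicator_def)
  also have "\<dots> = ennreal (0 - (- exp (- k * 0) / k))"
  proof (rule nn_integral_FTC_atLeast)
    show "((\<lambda>u. - exp (- k * u) / k) has_real_derivative exp (- k * u)) (at u)" for u
      using assms by (auto intro!: derivative_eq_intros)
    have "((\<lambda>u. exp (- k * u)) \<longlongrightarrow> 0) at_top"
      using assms
      by (intro filterlim_compose[OF exp_at_bot] filterlim_tendsto_neg_mult_at_bot[OF tendsto_const] filterlim_ident) auto
    from tendsto_divide[OF tendsto_minus[OF this] tendsto_const[of k]]
    show "((\<lambda>u. - exp (- k * u) / k) \<longlongrightarrow> 0) at_top"
      using assms by simp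
  qed auto
  finally show ?thesis
    by (rule le_less_trans) (simp add: ennreal_mult_less_top)
qed

text \<open>For a \<ge> 0 the factor exp (-a) decays by itself. For a < 0 it grows, but then
  \<omega> exp (-a) dominates \<eta> and the decay factor is of order exp (q a), leaving exp ((q -
  1) a). Hence the rate is the minimum of 1 and q - 1.\<close>

lemma exp_japanese_decay_bound:
  assumes "1 < q" "\<omega> \<noteq> 0"
  shows "\<exists>k>0. \<exists>C\<ge>0. \<forall>a. exp (- a) * japanese_decay q (\<eta> + \<omega> * exp (- a)) \<le> C * exp (- k * \<bar>a\<bar>)"
proof -
  \<comment> \<open>The 1 serves a \<ge> 0. The other summand comes from |\<omega>| exp (-a) \<le>
    (1 + |\<eta>|) (1 + |v|), raised to the power -q, with v the argument of the decay.\<close>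
  define C where "C = 1 + (1 + \<bar>\<eta>\<bar>) powr q * \<bar>\<omega>\<bar> powr (- q)"
  define k where "k = min 1 (q - 1)"
  have k: "0 < k" using assms by (simp add: k_def)
  have C: "0 \<le> C" by (simp add: C_def)
  have "exp (- a) * japanese_decay q (\<eta> + \<omega> * exp (- a)) \<le> C * exp (- k * \<bar>a\<bar>)" for a
  proof (cases "0 \<le> a")
    case True
    have "japanese_decay q (\<eta> + \<omega> * exp (- a)) \<le> 1"
      unfolding japanese_decay_def
      using powr_mono[of "- q" 0 "1 + \<bar>\<eta> + \<omega> * exp (- a)\<bar>"] assms by (simp split: if_splits)
    then have "exp (- a) * japanese_decay q (\<eta> + \<omega> * exp (- a)) \<le> exp (- a) * 1"
      by (intro mult_left_mono) auto
    also have "\<dots> \<le> exp (- k * \<bar>a\<bar>)"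
      using True k by (simp add: k_def mult_left_le_one_le)
    also have "\<dots> \<le> C * exp (- k * \<bar>a\<bar>)"
      by (simp add: C_def)
    finally show ?thesis .
  next
    case False
    define v where "v = \<eta> + \<omega> * exp (- a)"
    have "\<bar>\<omega>\<bar> * exp (- a) = \<bar>v - \<eta>\<bar>" by (simp add: v_def abs_mult)
    also have "\<dots> \<le> (1 + \<bar>\<eta>\<bar>) * (1 + \<bar>v\<bar>)"
    proof -
      have "0 \<le> \<bar>\<eta>\<bar> * \<bar>v\<bar>" by simp
      moreover have "(1 + \<bar>\<eta>\<bar>) * (1 + \<bar>v\<bar>) = 1 + \<bar>\<eta>\<bar> + \<bar>v\<bar> + \<bar>\<eta>\<bar> * \<bar>v\<bar>"
        by (simp add: algebra_simps)
      ultimately show ?thesis using abs_triangle_ineq4[of v \<eta>] by linarith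
    qed
    finally have le: "\<bar>\<omega>\<bar> * exp (- a) / (1 + \<bar>\<eta>\<bar>) \<le> 1 + \<bar>v\<bar>"
      by (simp add: divide_le_eq mult.commute add_pos_nonneg)
    have "japanese_decay q v \<le> (\<bar>\<omega>\<bar> * exp (- a) / (1 + \<bar>\<eta>\<bar>)) powr (- q)"
      unfolding japanese_decay_def using le assms
      by (intro powr_mono2') (auto intro!: divide_pos_pos mult_pos_pos add_pos_nonneg)
    also have "\<dots> = (1 + \<bar>\<eta>\<bar>) powr q * \<bar>\<omega>\<bar> powr (- q) * exp (q * a)"
    proof -
      have "(w * e / m) powr (- q) = m powr q * w powr (- q) * e powr (- q)"
        if "0 \<le> w" "0 \<le> e" "0 \<le> m" for w e m :: real
        using that by (simp add: powr_divide powr_mult powr_minus field_simps)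
      from this[of "\<bar>\<omega>\<bar>" "exp (- a)" "1 + \<bar>\<eta>\<bar>"] show ?thesis
        by (simp add: exp_powr_real mult.commute)
    qed
    also have "\<dots> \<le> C * exp (q * a)"
      by (intro mult_right_mono) (auto simp: C_def)
    finally have "exp (- a) * japanese_decay q v \<le> exp (- a) * (C * exp (q * a))"
      by (intro mult_left_mono) auto
    also have "\<dots> = C * exp ((q - 1) * a)"
      by (simp add: left_diff_distrib exp_diff exp_minus field_simps)
    also have "\<dots> \<le> C * exp (- k * \<bar>a\<bar>)"
    proof -
      have "k * (- a) \<le> (q - 1) * (- a)"
        using False by (intro mult_right_mono) (auto simp: k_def)
      then show ?thesis using C False by (intro mult_left_mono) auto
    qed
    finally show ?thesis by (simp add: v_def)
  qed
  with k C show ?thesis by blast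
qed

text \<open>Separation of variables: (1 + u^2 + v^2)^2 dominates (1 + u^2) (1 + v^2), and 1 + w^2
  dominates half of (1 + |w|)^2. Each variable receives the exponent s / 2, and s > 2 is what makes
  both one-dimensional integrals converge.\<close>

lemma powr_le_japanese_decay:
  assumes "0 \<le> s"
  shows "(1 + u\<^sup>2 + v\<^sup>2) powr (- s / 2) \<le>
    2 powr (s / 2) * (japanese_decay (s / 2) u * japanese_decay (s / 2) v)"
proof -
  have le: "(1 + \<bar>w\<bar>)\<^sup>2 / 2 \<le> 1 + w\<^sup>2" for w :: real
  proof -
    have "0 \<le> (1 - \<bar>w\<bar>)\<^sup>2" by simp
    then show ?thesis by (simp add: power2_sum power2_diff)
  qed
  have "((1 + \<bar>u\<bar>) * (1 + \<bar>v\<bar>) / 2)\<^sup>2 = ((1 + \<bar>u\<bar>)\<^sup>2 / 2) * ((1 + \<bar>v\<bar>)\<^sup>2 / 2)"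
    by (simp add: power_mult_distrib power_divide)
  also have "\<dots> \<le> (1 + u\<^sup>2) * (1 + v\<^sup>2)"
    by (intro mult_mono le) auto
  also have "\<dots> \<le> (1 + u\<^sup>2 + v\<^sup>2) * (1 + u\<^sup>2 + v\<^sup>2)"
    by (intro mult_mono) auto
  finally have "((1 + \<bar>u\<bar>) * (1 + \<bar>v\<bar>) / 2)\<^sup>2 \<le> (1 + u\<^sup>2 + v\<^sup>2)\<^sup>2"
    by (simp add: power2_eq_square)
  then have "(1 + \<bar>u\<bar>) * (1 + \<bar>v\<bar>) / 2 \<le> 1 + u\<^sup>2 + v\<^sup>2"
    by (rule power2_le_imp_le) simp
  then have "(1 + u\<^sup>2 + v\<^sup>2) powr (- s / 2) \<le> ((1 + \<bar>u\<bar>) * (1 + \<bar>v\<bar>) / 2) powr (- s / 2)"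
    using assms by (intro powr_mono2') (auto intro!: mult_pos_pos add_pos_nonneg)
  also have "\<dots> = 2 powr (s / 2) * (japanese_decay (s / 2) u * japanese_decay (s / 2) v)"
  proof -
    have "(x * y / 2) powr (- t) = 2 powr t * (x powr (- t) * y powr (- t))"
      if "0 \<le> x" "0 \<le> y" for x y t :: real
      using that by (simp add: powr_divide powr_mult powr_minus field_simps)
    from this[of "1 + \<bar>u\<bar>" "1 + \<bar>v\<bar>" "s / 2"] show ?thesis
      by (simp add: japanese_decay_def)
  qed
  finally show ?thesis .
qed

text \<open>Substitution u = exp (-a) (b - b'), with the Jacobian kept on the left so that the right
  side is free of a and b'.\<close>

lemma nn_integral_japanese_decay_dilate:
  "ennreal (exp (- a)) * (\<integral>\<^sup>+b. ennreal (japanese_decay q (exp (- a) * (b - b'))) \<partial>lborel)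
    = (\<integral>\<^sup>+u. ennreal (japanese_decay q u) \<partial>lborel)"
  by (subst (2) nn_integral_real_affine[where c="exp (- a)" and t="- exp (- a) * b'"])
    (simp_all add: algebra_simps)

section \<open>The symbol of \<Theta> (1 + D^2)^(-s/2) and its integrability\<close>

definition weight :: "real \<Rightarrow> real \<Rightarrow> real \<Rightarrow> real \<times> real \<Rightarrow> real" where
  "weight \<eta> \<omega> s y = exp (- fst y) * (1 + Dsq \<eta> \<omega> (fst y) (snd y)) powr (- s / 2)"

lemma weight_nonneg [simp]: "0 \<le> weight \<eta> \<omega> s y"
  by (simp add: weight_def)

lemma continuous_on_weight: "continuous_on UNIV (weight \<eta> \<omega> s)"
proof -
  have "1 + Dsq \<eta> \<omega> a b \<noteq> 0" for a b
    by (smt (verit) Dsq_def zero_le_power2)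
  then show ?thesis
    unfolding weight_def[abs_def] by (intro continuous_intros ballI) (auto simp: Dsq_def intro!: continuous_intros)
qed

text \<open>With x = exp (-a) and y = exp (-a) b the integral below becomes that of
  (1 + y^2 + (\<eta> + \<omega> x)^2)^(-s/2) over a half plane, which is finite exactly for s > 2.\<close>

lemma nn_integral_weight:
  assumes "2 < s" "\<omega> \<noteq> 0"
  shows "(\<integral>\<^sup>+y. ennreal (exp (- fst y) * weight \<eta> \<omega> s y) \<partial>lborel) < \<infinity>"
proof -
  obtain C k where "0 < k" "0 \<le> C" and
    C: "\<And>a. exp (- a) * japanese_decay (s / 2) (\<eta> + \<omega> * exp (- a)) \<le> C * exp (- k * \<bar>a\<bar>)"
    using exp_japanese_decay_bound[of "s / 2" \<omega> \<eta>] assms by fastforce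
  define I where "I = (\<integral>\<^sup>+u. ennreal (japanese_decay (s / 2) u) \<partial>lborel)"
  have I: "I < \<infinity>"
    unfolding I_def using assms by (intro nn_integral_japanese_decay) simp
  define M where "M = 2 powr (s / 2) * C"
  have "0 \<le> M" using \<open>0 \<le> C\<close> by (simp add: M_def)
  have "(\<lambda>y. exp (- fst y) * weight \<eta> \<omega> s y) \<in> borel_measurable borel"
    by (intro borel_measurable_continuous_onI continuous_intros continuous_on_weight)
  then have meas: "(\<lambda>y. ennreal (exp (- fst y) * weight \<eta> \<omega> s y)) \<in> borel_measurable borel"
    by measurable
  \<comment> \<open>Of the two factors exp (-a), one joins the decay in \<eta> + \<omega> exp (-a)
    to give exponential decay in a; the other is the Jacobian of the b-integral. The term
    \<open>b - 0\<close> matches the dilation lemma.\<close>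
  have pt: "exp (- a) * weight \<eta> \<omega> s (a, b) \<le>
    M * exp (- k * \<bar>a\<bar>) * (exp (- a) * japanese_decay (s / 2) (exp (- a) * (b - 0)))" for a b
  proof -
    have "exp (- a) * weight \<eta> \<omega> s (a, b) \<le> exp (- a) * (exp (- a) *
      (2 powr (s / 2) * (japanese_decay (s / 2) (exp (- a) * b) * japanese_decay (s / 2) (\<eta> + \<omega> * exp (- a)))))"
      using powr_le_japanese_decay[of s "exp (- a) * b" "\<eta> + \<omega> * exp (- a)"] assms
      by (intro mult_left_mono) (auto simp: weight_def Dsq_def add.assoc)
    also have "\<dots> = 2 powr (s / 2) * (exp (- a) * japanese_decay (s / 2) (\<eta> + \<omega> * exp (- a))) *
      (exp (- a) * japanese_decay (s / 2) (exp (- a) * b))"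
      by (simp add: mult_ac)
    also have "\<dots> \<le> 2 powr (s / 2) * (C * exp (- k * \<bar>a\<bar>)) * (exp (- a) * japanese_decay (s / 2) (exp (- a) * b))"
      by (intro mult_right_mono mult_left_mono C) auto
    finally show ?thesis by (simp add: M_def mult.assoc)
  qed
  have "(\<integral>\<^sup>+y. ennreal (exp (- fst y) * weight \<eta> \<omega> s y) \<partial>lborel)
      = (\<integral>\<^sup>+a. \<integral>\<^sup>+b. ennreal (exp (- a) * weight \<eta> \<omega> s (a, b)) \<partial>lborel \<partial>lborel)"
    using nn_integral_lborel_pair(1)[OF meas] by simp
  also have "\<dots> \<le> (\<integral>\<^sup>+a. \<integral>\<^sup>+b. ennreal (M * exp (- k * \<bar>a\<bar>)) *
      (ennreal (exp (- a)) * ennreal (japanese_decay (s / 2) (exp (- a) * (b - 0)))) \<partial>lborel \<partial>lborel)"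
    using pt \<open>0 \<le> M\<close> by (intro nn_integral_mono) (simp flip: ennreal_mult)
  also have "\<dots> = (\<integral>\<^sup>+a. ennreal (M * exp (- k * \<bar>a\<bar>)) * I \<partial>lborel)"
  proof (intro nn_integral_cong)
    fix a :: real
    show "(\<integral>\<^sup>+b. ennreal (M * exp (- k * \<bar>a\<bar>)) *
      (ennreal (exp (- a)) * ennreal (japanese_decay (s / 2) (exp (- a) * (b - 0)))) \<partial>lborel)
      = ennreal (M * exp (- k * \<bar>a\<bar>)) * I"
      unfolding I_def nn_integral_japanese_decay_dilate[of a _ 0, symmetric]
      by (simp add: nn_integral_cmult)
  qed
  also have "\<dots> = ennreal M * (\<integral>\<^sup>+a. ennreal (exp (- k * \<bar>a\<bar>)) \<partial>lborel) * I"
    using \<open>0 \<le> M\<close> by (simp add: nn_integral_multc nn_integral_cmult ennreal_mult)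
  also have "\<dots> < \<infinity>"
    using nn_integral_exp_decay[OF \<open>0 < k\<close>] I by (simp add: ennreal_mult_less_top)
  finally show ?thesis .
qed

section \<open>The kernel of the representation\<close>

text \<open>The integral kernel of \<open>piop f\<close>, obtained by reflecting the integration
  variable p to x - p.\<close>

definition kern :: "(real \<Rightarrow> real \<Rightarrow> complex) \<Rightarrow> (real \<times> real) \<times> (real \<times> real) \<Rightarrow> complex" where
  "kern f p = (case p of ((a, b), (a', b')) \<Rightarrow>
     complex_of_real (exp (- a)) * f (a - a') (exp (- a) * (b - b')))"

lemma A_S_continuous:
  assumes "f \<in> A_S"
  shows "continuous_on UNIV (\<lambda>p. f (fst p) (snd p))"
proof -
  have "schwartz f" using assms by (simp add: A_S_def)
  then have "continuous_on UNIV (\<lambda>p. iterpd [] f (fst p) (snd p))"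
    unfolding schwartz_def by blast
  then show ?thesis by (simp add: iterpd_def)
qed

text \<open>The sup bounds on f and on b f add up to one on (1 + |b|) |f|; squaring it gives the
  exponent 2, which is integrable in b.\<close>

lemma A_S_decay:
  assumes "f \<in> A_S"
  shows "\<exists>C\<ge>0. \<exists>K\<ge>0. \<forall>a b. (cmod (f a b))\<^sup>2 \<le> C * indicator {-K..K} a * japanese_decay 2 b"
proof -
  have "schwartz f" using assms by (simp add: A_S_def)
  then have bnd: "\<exists>C. \<forall>a b. \<bar>a\<bar> ^ k * \<bar>b\<bar> ^ l * cmod (iterpd [] f a b) \<le> C" for k l
    unfolding schwartz_def by blast
  obtain C0 where C0: "\<And>a b. cmod (f a b) \<le> C0"
    using bnd[of 0 0] by (auto simp: iterpd_def)
  obtain C1 where C1: "\<And>a b. \<bar>b\<bar> * cmod (f a b) \<le> C1"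
    using bnd[of 0 1] by (auto simp: iterpd_def)
  obtain K where K: "\<And>a b. K < \<bar>a\<bar> \<Longrightarrow> f a b = 0"
    using assms by (auto simp: A_S_def)
  \<comment> \<open>\<open>A_S\<close> fixes no sign for K; the absolute value gives a nonnegative
    radius.\<close>
  have "(cmod (f a b))\<^sup>2 \<le> (C0 + C1)\<^sup>2 * indicator {- \<bar>K\<bar>..\<bar>K\<bar>} a * japanese_decay 2 b" for a b
  proof (cases "\<bar>a\<bar> \<le> \<bar>K\<bar>")
    case True
    have "(1 + \<bar>b\<bar>) * cmod (f a b) \<le> C0 + C1"
      using C0[of a b] C1[of b a] by (simp add: distrib_right)
    then have "((1 + \<bar>b\<bar>) * cmod (f a b))\<^sup>2 \<le> (C0 + C1)\<^sup>2"
      by (intro power_mono) auto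
    then have "(cmod (f a b))\<^sup>2 \<le> (C0 + C1)\<^sup>2 / (1 + \<bar>b\<bar>)\<^sup>2"
      by (simp add: pos_le_divide_eq power_mult_distrib mult.commute add_pos_nonneg)
    also have "\<dots> = (C0 + C1)\<^sup>2 * indicator {- \<bar>K\<bar>..\<bar>K\<bar>} a * japanese_decay 2 b"
      using True by (simp add: japanese_decay_def powr_minus divide_inverse indicator_def abs_le_iff)
    finally show ?thesis .
  next
    case False
    then have "f a b = 0" by (intro K) auto
    then show ?thesis by simp
  qed
  then show ?thesis
    by (intro exI[of _ "(C0 + C1)\<^sup>2"] exI[of _ "\<bar>K\<bar>"] conjI) auto
qed

lemma continuous_on_kern:
  assumes "f \<in> A_S"
  shows "continuous_on UNIV (kern f)"
proof -
  have "continuous_on UNIV (\<lambda>p. f (fst (g p)) (snd (g p)))" if "continuous_on UNIV g"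
    for g :: "(real \<times> real) \<times> (real \<times> real) \<Rightarrow> real \<times> real"
    using continuous_on_compose2[OF A_S_continuous[OF assms] that] by simp
  from this[of "\<lambda>p. (fst (fst p) - fst (snd p), exp (- fst (fst p)) * (snd (fst p) - snd (snd p)))"]
  have "continuous_on UNIV (\<lambda>p. f (fst (fst p) - fst (snd p)) (exp (- fst (fst p)) * (snd (fst p) - snd (snd p))))"
    by (simp add: continuous_intros)
  then show ?thesis
    unfolding kern_def[abs_def] case_prod_beta by (intro continuous_intros)
qed

lemma measurable_kern:
  assumes "f \<in> A_S"
  shows "kern f \<in> borel_measurable borel"
  using continuous_on_kern[OF assms] by (rule borel_measurable_continuous_onI)

text \<open>The factor exp (-2a) of the squared kernel is split: one exp (-a) is the Jacobian of the
  b-integral, the other survives the integration.\<close>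

lemma kern_bound:
  assumes "\<And>a b. (cmod (f a b))\<^sup>2 \<le> C * indicator {-K..K} a * japanese_decay 2 b" "0 \<le> C"
  shows "ennreal ((cmod (kern f ((a, b), (a', b'))))\<^sup>2) \<le> ennreal (C * exp (- a)) * indicator {-K..K} (a - a') *
     (ennreal (exp (- a)) * ennreal (japanese_decay 2 (exp (- a) * (b - b'))))"
proof -
  have "(cmod (kern f ((a, b), (a', b'))))\<^sup>2 = (exp (- a))\<^sup>2 * (cmod (f (a - a') (exp (- a) * (b - b'))))\<^sup>2"
    by (simp add: kern_def norm_mult power_mult_distrib)
  also have "\<dots> \<le> (exp (- a))\<^sup>2 * (C * indicator {-K..K} (a - a') * japanese_decay 2 (exp (- a) * (b - b')))"
    by (intro mult_left_mono assms(1)) auto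
  also have "\<dots> = (C * exp (- a)) * indicator {-K..K} (a - a') * (exp (- a) * japanese_decay 2 (exp (- a) * (b - b')))"
    by (simp add: power2_eq_square mult_ac)
  finally show ?thesis
    using ennreal_leI assms(2) by (fastforce simp: ennreal_mult ennreal_indicator)
qed

text \<open>In a row a is fixed, and exp (-a) comes out directly. In a column a varies, but the
  support condition |a - a'| \<le> K bounds exp (-a) by exp K times exp (-a'). So both integrals
  decay in the variable that is kept.\<close>

lemma nn_integral_kern_le:
  assumes "f \<in> A_S"
  shows "\<exists>M<\<infinity>. (\<forall>x. (\<integral>\<^sup>+y. ennreal ((cmod (kern f (x, y)))\<^sup>2) \<partial>lborel) \<le> M * ennreal (exp (- fst x))) \<and>
    (\<forall>y. (\<integral>\<^sup>+x. ennreal ((cmod (kern f (x, y)))\<^sup>2) \<partial>lborel) \<le> M * ennreal (exp (- fst y)))"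
proof -
  obtain C K where CK: "0 \<le> C" "0 \<le> K"
    and bound: "\<And>a b. (cmod (f a b))\<^sup>2 \<le> C * indicator {-K..K} a * japanese_decay 2 b"
    using A_S_decay[OF assms] by blast
  have [measurable]: "kern f \<in> borel_measurable borel"
    by (rule measurable_kern[OF assms])
  define I where "I = (\<integral>\<^sup>+u. ennreal (japanese_decay 2 u) \<partial>lborel)"
  have I: "I < \<infinity>" unfolding I_def by (rule nn_integral_japanese_decay) simp
  \<comment> \<open>I is the b-integral, 2 K the length of the support in a, and exp K the price of
    replacing exp (-a) by exp (-a').\<close>
  define M where "M = ennreal (C * exp K * (2 * K)) * I"
  have M: "M < \<infinity>" using I by (simp add: M_def ennreal_mult_less_top)
  have "(\<integral>\<^sup>+y. ennreal ((cmod (kern f ((a, b), y)))\<^sup>2) \<partial>lborel) \<le> M * ennreal (exp (- a))" for a b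
  proof -
    have "(\<integral>\<^sup>+y. ennreal ((cmod (kern f ((a, b), y)))\<^sup>2) \<partial>lborel)
        = (\<integral>\<^sup>+a'. \<integral>\<^sup>+b'. ennreal ((cmod (kern f ((a, b), (a', b'))))\<^sup>2) \<partial>lborel \<partial>lborel)"
      by (subst nn_integral_lborel_pair(1)) auto
    also have "\<dots> \<le> (\<integral>\<^sup>+a'. \<integral>\<^sup>+b'. ennreal (C * exp (- a)) * indicator {-K..K} (a - a') *
     (ennreal (exp (- a)) * ennreal (japanese_decay 2 (exp (- a) * (b - b')))) \<partial>lborel \<partial>lborel)"
      by (intro nn_integral_mono kern_bound bound CK)
    also have "\<dots> = (\<integral>\<^sup>+a'. ennreal (C * exp (- a)) * I * indicator {a - K..a + K} a' \<partial>lborel)"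
    proof (intro nn_integral_cong)
      fix a' :: real
      \<comment> \<open>The dilation lemma integrates over the first of the two b-variables;
        evenness of the decay exchanges them.\<close>
      have sym: "japanese_decay 2 (exp (- a) * (b - b')) = japanese_decay 2 (exp (- a) * (b' - b))" for b'
        using japanese_decay_minus[of 2 "exp (- a) * (b - b')"] by (simp add: algebra_simps)
      show "(\<integral>\<^sup>+b'. ennreal (C * exp (- a)) * indicator {-K..K} (a - a') *
          (ennreal (exp (- a)) * ennreal (japanese_decay 2 (exp (- a) * (b - b')))) \<partial>lborel)
        = ennreal (C * exp (- a)) * I * indicator {a - K..a + K} a'"
        unfolding I_def nn_integral_japanese_decay_dilate[of a _ b, symmetric] sym
        by (simp add: nn_integral_cmult) (auto simp: indicator_def)
    qed
    also have "\<dots> = ennreal (C * exp (- a)) * I * ennreal (2 * K)"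
      using CK by (simp add: nn_integral_cmult_indicator)
    also have "\<dots> = ennreal (C * (2 * K)) * I * ennreal (exp (- a))"
      using CK by (simp add: ennreal_mult mult_ac)
    also have "\<dots> \<le> M * ennreal (exp (- a))"
      unfolding M_def using CK by (intro mult_right_mono ennreal_leI) (auto intro!: mult_right_mono simp: mult_le_cancel_left1)
    finally show ?thesis .
  qed
  moreover have "(\<integral>\<^sup>+x. ennreal ((cmod (kern f (x, (a', b'))))\<^sup>2) \<partial>lborel) \<le> M * ennreal (exp (- a'))" for a' b'
  proof -
    have "(\<integral>\<^sup>+x. ennreal ((cmod (kern f (x, (a', b'))))\<^sup>2) \<partial>lborel)
        = (\<integral>\<^sup>+a. \<integral>\<^sup>+b. ennreal ((cmod (kern f ((a, b), (a', b'))))\<^sup>2) \<partial>lborel \<partial>lborel)"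
      by (subst nn_integral_lborel_pair(1)) auto
    also have "\<dots> \<le> (\<integral>\<^sup>+a. \<integral>\<^sup>+b. ennreal (C * exp (- a)) * indicator {-K..K} (a - a') *
     (ennreal (exp (- a)) * ennreal (japanese_decay 2 (exp (- a) * (b - b')))) \<partial>lborel \<partial>lborel)"
      by (intro nn_integral_mono kern_bound bound CK)
    also have "\<dots> = (\<integral>\<^sup>+a. ennreal (C * exp (- a)) * indicator {-K..K} (a - a') * I \<partial>lborel)"
    proof (intro nn_integral_cong)
      fix a :: real
      show "(\<integral>\<^sup>+b. ennreal (C * exp (- a)) * indicator {-K..K} (a - a') *
          (ennreal (exp (- a)) * ennreal (japanese_decay 2 (exp (- a) * (b - b')))) \<partial>lborel)
        = ennreal (C * exp (- a)) * indicator {-K..K} (a - a') * I"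
        unfolding I_def nn_integral_japanese_decay_dilate[of a _ b', symmetric]
        by (simp add: nn_integral_cmult)
    qed
    also have "\<dots> \<le> (\<integral>\<^sup>+a. (ennreal (C * exp (K - a')) * I) * indicator {a' - K..a' + K} a \<partial>lborel)"
    proof (intro nn_integral_mono)
      fix a :: real
      have "C * exp (- a) \<le> C * exp (K - a')" if "a' - K \<le> a"
        using that CK by (intro mult_left_mono) auto
      then show "ennreal (C * exp (- a)) * indicator {-K..K} (a - a') * I
          \<le> (ennreal (C * exp (K - a')) * I) * indicator {a' - K..a' + K} a"
        by (auto simp: indicator_def intro!: mult_right_mono ennreal_leI)
    qed
    also have "\<dots> = ennreal (C * exp (K - a')) * I * ennreal (2 * K)"
      using CK by (simp add: nn_integral_cmult_indicator)
    also have "\<dots> = M * ennreal (exp (- a'))"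
      using CK by (simp add: M_def ennreal_mult mult_ac exp_diff exp_minus divide_inverse)
    finally show ?thesis .
  qed
  ultimately show ?thesis using M by (intro exI[of _ M]) auto
qed

text \<open>In both cases the variable without weight is integrated first, by the column bound or
  the row bound. What remains is a multiple of the integral of exp (-a) against the weight.\<close>

lemma square_integrable_weighted_kern:
  assumes "f \<in> A_S" "2 < s" "\<omega> \<noteq> 0"
  shows "square_integrable lborel (\<lambda>(x, y). kern f (x, y) * complex_of_real (sqrt (weight \<eta> \<omega> s y)))"
    and "square_integrable lborel (\<lambda>(x, y). complex_of_real (sqrt (weight \<eta> \<omega> s x)) * kern f (x, y))"
proof -
  obtain M where "M < \<infinity>"
    and M1: "\<And>x. (\<integral>\<^sup>+y. ennreal ((cmod (kern f (x, y)))\<^sup>2) \<partial>lborel) \<le> M * ennreal (exp (- fst x))"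
    and M2: "\<And>y. (\<integral>\<^sup>+x. ennreal ((cmod (kern f (x, y)))\<^sup>2) \<partial>lborel) \<le> M * ennreal (exp (- fst y))"
    using nn_integral_kern_le[OF assms(1)] by blast
  let ?w = "weight \<eta> \<omega> s"
  have [measurable]: "kern f \<in> borel_measurable borel"
    by (rule measurable_kern[OF assms(1)])
  have [measurable]: "?w \<in> borel_measurable borel"
    using continuous_on_weight by (rule borel_measurable_continuous_onI)
  have fin: "(\<integral>\<^sup>+y. ennreal (?w y) * (M * ennreal (exp (- fst y))) \<partial>lborel) < \<infinity>"
  proof -
    have "(\<integral>\<^sup>+y. ennreal (?w y) * (M * ennreal (exp (- fst y))) \<partial>lborel)
        = (\<integral>\<^sup>+y. M * ennreal (exp (- fst y) * ?w y) \<partial>lborel)"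
      by (intro nn_integral_cong) (simp add: ennreal_mult mult_ac)
    also have "\<dots> = M * (\<integral>\<^sup>+y. ennreal (exp (- fst y) * ?w y) \<partial>lborel)"
    proof (rule nn_integral_cmult)
      have "(\<lambda>y. exp (- fst y) * ?w y) \<in> borel_measurable borel"
        by (intro borel_measurable_continuous_onI continuous_intros continuous_on_weight)
      then show "(\<lambda>y. ennreal (exp (- fst y) * ?w y)) \<in> borel_measurable lborel" by simp
    qed
    also have "\<dots> < \<infinity>"
      using \<open>M < \<infinity>\<close> nn_integral_weight[OF assms(2,3), of \<eta>] by (simp add: ennreal_mult_less_top)
    finally show ?thesis .
  qed
  have cont: "continuous_on UNIV (\<lambda>p. complex_of_real (sqrt (?w (h p))))" if "continuous_on UNIV h"
    for h :: "(real \<times> real) \<times> (real \<times> real) \<Rightarrow> real \<times> real"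
    using that by (intro continuous_intros continuous_on_compose2[OF continuous_on_weight]) auto
  show "square_integrable lborel (\<lambda>(x, y). kern f (x, y) * complex_of_real (sqrt (?w y)))" (is "square_integrable _ ?A")
  proof (rule square_integrableI)
    have "continuous_on UNIV ?A"
      unfolding case_prod_beta prod.collapse
      by (intro continuous_intros cont continuous_on_kern assms)
    then have [measurable]: "?A \<in> borel_measurable borel"
      by (rule borel_measurable_continuous_onI)
    then show "?A \<in> borel_measurable lborel" by simp
    have "(\<integral>\<^sup>+p. ennreal ((cmod (?A p))\<^sup>2) \<partial>lborel)
        = (\<integral>\<^sup>+y. \<integral>\<^sup>+x. ennreal ((cmod (?A (x, y)))\<^sup>2) \<partial>lborel \<partial>lborel)"
      by (rule nn_integral_lborel_pair(2)) measurable
    also have "\<dots> = (\<integral>\<^sup>+y. ennreal (?w y) * (\<integral>\<^sup>+x. ennreal ((cmod (kern f (x, y)))\<^sup>2) \<partial>lborel) \<partial>lborel)"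
      by (intro nn_integral_cong, subst nn_integral_cmult[symmetric])
        (auto simp: norm_mult power_mult_distrib mult.commute simp flip: ennreal_mult)
    also have "\<dots> \<le> (\<integral>\<^sup>+y. ennreal (?w y) * (M * ennreal (exp (- fst y))) \<partial>lborel)"
      by (intro nn_integral_mono mult_left_mono M2) auto
    finally show "(\<integral>\<^sup>+p. ennreal ((cmod (?A p))\<^sup>2) \<partial>lborel) < \<infinity>"
      using fin by (rule le_less_trans)
  qed
  show "square_integrable lborel (\<lambda>(x, y). complex_of_real (sqrt (?w x)) * kern f (x, y))" (is "square_integrable _ ?A")
  proof (rule square_integrableI)
    have "continuous_on UNIV ?A"
      unfolding case_prod_beta prod.collapse
      by (intro continuous_intros cont continuous_on_kern assms)
    then have [measurable]: "?A \<in> borel_measurable borel"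
      by (rule borel_measurable_continuous_onI)
    then show "?A \<in> borel_measurable lborel" by simp
    have "(\<integral>\<^sup>+p. ennreal ((cmod (?A p))\<^sup>2) \<partial>lborel)
        = (\<integral>\<^sup>+x. \<integral>\<^sup>+y. ennreal ((cmod (?A (x, y)))\<^sup>2) \<partial>lborel \<partial>lborel)"
      by (rule nn_integral_lborel_pair(1)) measurable
    also have "\<dots> = (\<integral>\<^sup>+x. ennreal (?w x) * (\<integral>\<^sup>+y. ennreal ((cmod (kern f (x, y)))\<^sup>2) \<partial>lborel) \<partial>lborel)"
      by (intro nn_integral_cong, subst nn_integral_cmult[symmetric])
        (auto simp: norm_mult power_mult_distrib mult.commute simp flip: ennreal_mult)
    also have "\<dots> \<le> (\<integral>\<^sup>+x. ennreal (?w x) * (M * ennreal (exp (- fst x))) \<partial>lborel)"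
      by (intro nn_integral_mono mult_left_mono M1) auto
    finally show "(\<integral>\<^sup>+p. ennreal ((cmod (?A p))\<^sup>2) \<partial>lborel) < \<infinity>"
      using fin by (rule le_less_trans)
  qed
qed

section \<open>The operator as a product of two weighted integral operators\<close>

lemma lborel_integral_reflect:
  fixes h :: "'a::euclidean_space \<Rightarrow> complex"
  assumes [measurable]: "h \<in> borel_measurable borel"
  shows "(LINT p|lborel. h (x - p)) = (LINT y|lborel. h y)"
proof -
  have eq: "lborel = distr lborel borel (\<lambda>p. x - p)"
    using lborel_affine[of "- 1" x] by (simp add: density_1)
  show ?thesis
    by (subst (2) eq, subst integral_distr) auto
qed

text \<open>The equality holds at every point, as \<open>trace_class_componentwise\<close> requires:
  moving exp (-a) into the integral and reflecting the variable both preserve the default value 0 of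
  a non-integrable integrand.\<close>

lemma piop_eq_kernel_op:
  assumes f: "f \<in> A_S" and \<xi>: "(\<lambda>y. \<xi> (y, i)) \<in> borel_measurable borel"
  shows "piop f \<xi> (x, i) = kernel_op (kern f) (\<lambda>y. \<xi> (y, i)) x"
proof -
  obtain a b where x: "x = (a, b)" by (cases x)
  have [measurable]: "kern f \<in> borel_measurable borel"
    by (rule measurable_kern[OF f])
  have "piop f \<xi> (x, i) = (LINT p|lborel. kern f (x, x - p) * \<xi> (x - p, i))"
    unfolding piop_def x prod.case
    by (subst Bochner_Integration.integral_mult_right_zero[symmetric])
      (auto simp: kern_def case_prod_beta mult.assoc intro!: Bochner_Integration.integral_cong)
  also have "\<dots> = kernel_op (kern f) (\<lambda>y. \<xi> (y, i)) x"
    unfolding kernel_op_def using \<xi> by (intro lborel_integral_reflect) measurable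
  finally show ?thesis .
qed

theorem mainTheorem1:
  fixes \<eta> \<omega> s :: real and f g :: "real \<Rightarrow> real \<Rightarrow> complex"
  assumes "\<omega> \<noteq> 0" and "f \<in> A_S" and "g \<in> A_S" and "s > 2"
  shows "trace_class (piop f \<circ> Thetaop \<circ> resolv \<eta> \<omega> s \<circ> piop g)"
proof -
  let ?w = "weight \<eta> \<omega> s"
  define A where "A = (\<lambda>(x, y). kern f (x, y) * complex_of_real (sqrt (?w y)))"
  define B where "B = (\<lambda>(x, y). complex_of_real (sqrt (?w x)) * kern g (x, y))"
  have A: "square_integrable lborel A" and B: "square_integrable lborel B"
    unfolding A_def B_def using assms by (intro square_integrable_weighted_kern; simp)+
  have cont: "continuous_on UNIV B"
    unfolding B_def case_prod_beta prod.collapse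
    by (intro continuous_intros continuous_on_compose2[OF continuous_on_weight] continuous_on_kern assms) auto
  have [measurable]: "kern g \<in> borel_measurable borel"
    by (rule measurable_kern[OF assms(3)])
  have w [measurable]: "?w \<in> borel_measurable borel"
    using continuous_on_weight by (rule borel_measurable_continuous_onI)
  obtain u v where u: "\<And>n. square_integrable lborel (u n)" and v: "\<And>n. square_integrable lborel (v n)"
    and summable: "summable (\<lambda>n::nat. l2 lborel (u n) * l2 lborel (v n))"
    and lim: "\<And>\<xi>. square_integrable lborel \<xi> \<Longrightarrow> (\<lambda>N. l2 lborel (\<lambda>x. kernel_op A (kernel_op B \<xi>) x -
        (\<Sum>n<N. (LINT z|lborel. cnj (u n z) * \<xi> z) * v n x))) \<longlonglongrightarrow> 0"
    using nuclear_decomposition[OF A B cont] by blast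
  show ?thesis
  proof (rule trace_class_componentwise[where ?T0.0 = "\<lambda>\<xi>. kernel_op A (kernel_op B \<xi>)", OF _ _ u v summable lim])
    fix \<xi> :: "(real \<times> real) \<times> bool \<Rightarrow> complex" and x :: "real \<times> real" and i :: bool
    assume "inL2 \<xi>"
    then have [measurable]: "(\<lambda>y. \<xi> (y, i)) \<in> borel_measurable borel"
      using square_integrable_measurable by (fastforce simp: inL2_eq square_integrable_hmeas_iff)
    let ?h = "kernel_op (kern g) (\<lambda>y. \<xi> (y, i))"
    have [measurable]: "?h \<in> borel_measurable borel"
      by (rule measurable_kernel_op) measurable
    have mult: "(Thetaop \<circ> resolv \<eta> \<omega> s \<circ> piop g) \<xi> (y, i) = complex_of_real (?w y) * ?h y" for y
      by (cases y) (simp add: Thetaop_def resolv_def weight_def piop_eq_kernel_op[OF assms(3)])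
    have "(piop f \<circ> Thetaop \<circ> resolv \<eta> \<omega> s \<circ> piop g) \<xi> (x, i)
        = piop f ((Thetaop \<circ> resolv \<eta> \<omega> s \<circ> piop g) \<xi>) (x, i)" by simp
    also have "\<dots> = kernel_op (kern f) (\<lambda>y. complex_of_real (?w y) * ?h y) x"
      unfolding mult[symmetric]
      by (rule piop_eq_kernel_op[OF assms(2)]) (unfold mult, measurable)
    also have "\<dots> = kernel_op A (kernel_op B (\<lambda>y. \<xi> (y, i))) x"
    proof -
      \<comment> \<open>A constant factor leaves the Bochner integral whether or not the integrand
        is integrable, so this too holds for every y.\<close>
      have "kernel_op B (\<lambda>y. \<xi> (y, i)) y = complex_of_real (sqrt (?w y)) * ?h y" for y
        by (simp add: kernel_op_def B_def mult.assoc)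
      moreover have "complex_of_real (?w y) = complex_of_real (sqrt (?w y)) * complex_of_real (sqrt (?w y))" for y
        by (simp flip: of_real_mult)
      ultimately show ?thesis
        unfolding kernel_op_def[of A] kernel_op_def[of "kern f"] by (simp add: A_def mult.assoc)
    qed
    finally show "(piop f \<circ> Thetaop \<circ> resolv \<eta> \<omega> s \<circ> piop g) \<xi> (x, i) = kernel_op A (kernel_op B (\<lambda>y. \<xi> (y, i))) x" .
  qed (intro kernel_op_Hilbert_Schmidt A B)
qed

end
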